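(* Let $\{\alpha_n\}_{n\ge 0}$, $\{\gamma_n\}_{n\ge 0}$ be real sequences with $\alpha_0=0$ and $\gamma_n>0$, $\alpha_{n+1}>0$ for all $n\ge 0$. Put $\beta_n=\alpha_n+\gamma_n$ and $\lambda_n=\sqrt{\alpha_{n+1}\gamma_n}$ for $n\ge 0$, and $h(0)=1$, $h(n)=\dfrac{\gamma_0\gamma_1\cdots\gamma_{n-1}}{\alpha_1\alpha_2\cdots\alpha_n}$ for $n\ge 1$. Let $\{R_n\}_{n\ge 0}$ be the polynomials defined by $R_0(x)\equiv 1$ and $$xR_n(x)=-\gamma_nR_{n+1}(x)+\beta_nR_n(x)-\alpha_nR_{n-1}(x),\qquad n\ge 0.$$ Assume there are constants $q,\kappa,s,c$ and $N$ such that \begin{align*} &\alpha_n\approx q^n,\quad \gamma_n\approx q^n, && 0<q<1,\\ &\alpha_n\le \kappa\gamma_n \ \ (n\ge 0), && 1\le\kappa<q^{-1}+q-1,\\ &h(n)\sim s^n, && s>1,\\ &\lambda_n\le \beta_{n+1}-c\,\beta_{n+2}\ \ (n\ge 0), && \frac{1+q}{1+q^2}<c<\frac1q,\\ &\beta_1\le\beta_0,\\ &\beta_n-c\,\beta_{n+1}\ge \beta_{n+1}-c\,\beta_{n+2}, && n\ge N. \end{align*} Then the orthogonality measure $\mu$ of $\{R_n\}_{n\ge 0}$ is concentrated on a decreasing sequence $\{\xi_n\}_{n=1}^\infty$, where $\xi_n\sim q^n$, the quantity $1-\xi_{n+1}/\xi_n$ is bounded away from $0$ (i.e. there is $\delta>0$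 with $1-\xi_{n+1}/\xi_n\ge\delta$ for all $n\ge 1$), and $\mu([0,\xi_n])\sim s^{-n}$.
   Context: Notation: $a_n\approx b_n$ means that the ratio $a_n/b_n$ has a positive (finite) limit as $n\to\infty$; $a_n\sim b_n$ means that the ratio $a_n/b_n$ is positive, bounded, and bounded away from zero. For $n=0$ the term $\alpha_0R_{-1}$ in the recurrence is zero, so the polynomials satisfy $R_n(0)=1$ for all $n$. The polynomials $p_n(x)=\sqrt{h(n)}\,R_n(x)$ satisfy $xp_n=-\lambda_np_{n+1}+\beta_np_n-\lambda_{n-1}p_{n-1}$. The orthogonality measure $\mu$ is the Borel probability measure on $\mathbb{R}$ for which the $p_n$ are orthonormal, i.e. $\int p_np_m\,d\mu=\delta_{nm}$ for all $n,m\ge 0$; it is uniquely determined because the recurrence coefficients are bounded, and it is supported in $[0,+\infty)$. "$\mu$ is concentrated on $\{\xi_n\}_{n=1}^\infty$" means $\mu(\mathbb{R}\setminus\{\xi_n: n\ge 1\})=0$. *)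

theory Defs
  imports "HOL-Probability.Probability" "HOL-Computational_Algebra.Polynomial"
begin

definition ratio_tends_pos :: "(nat \<Rightarrow> real) \<Rightarrow> (nat \<Rightarrow> real) \<Rightarrow> bool"
    (infix "\<approx>\<approx>" 50) where
  "a \<approx>\<approx> b \<longleftrightarrow> (\<exists>L>0. (\<lambda>n. a n / b n) \<longlonglongrightarrow> L)"

(* Unlike bigtheta, the two bounds hold at every index in I, not only eventually,
   and the ratio has to be positive. *)
definition comparable_on :: "nat set \<Rightarrow> (nat \<Rightarrow> real) \<Rightarrow> (nat \<Rightarrow> real) \<Rightarrow> bool" where
  "comparable_on I a b \<longleftrightarrow> (\<exists>m>0. \<exists>C. \<forall>n\<in>I. m \<le> a n / b n \<and> a n / b n \<le> C)"

definition orthonormal_wrt :: "(nat \<Rightarrow> real poly) \<Rightarrow> real measure \<Rightarrow> bool" where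
  "orthonormal_wrt p \<mu> \<longleftrightarrow>
     (\<forall>n m. has_bochner_integral \<mu> (\<lambda>x. poly (p n) x * poly (p m) x) (if n = m then 1 else 0))"

end

theory Submission
  imports Defs
begin

text \<open>
  Summing the recurrence gives \<open>\<gamma> n * h n * (R (n + 1) x - R n x) = - x * (\<Sum>k\<le>n. h k * R k x)\<close>,
  and \<open>h\<close> grows geometrically; hence at the scale \<open>x \<sim> q ^ n\<close> the values \<open>R k x\<close> with \<open>k \<le> n + O(1)\<close>
  are bounded and Lipschitz in \<open>x / q ^ n\<close>, and \<open>R k x\<close> is close to 1 for \<open>k \<le> n - O(1)\<close>.
  Above that scale the recurrence forces \<open>p\<^sub>k(x)\<close> to grow or decay exponentially in \<open>k\<close>, and \<open>\<mu>\<close> lives on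
  the set of those \<open>x > 0\<close> where it decays. These are eigenvalues of the compact Jacobi matrix, with
  eigenvectors \<open>(p\<^sub>k(x))\<^sub>k\<close>. The quadratic form on vectors vanishing in the first \<open>n\<close> coordinates
  bounds the \<open>(n + 1)\<close>-st eigenvalue from above by \<open>O(q ^ n)\<close>; testing \<open>\<mu>\<close> against a polynomial that vanishes
  at the \<open>n\<close> largest eigenvalues bounds it from below. Two eigenvalues at scale \<open>q ^ n\<close>
  whose difference is much smaller than \<open>q ^ n\<close> would have nearly equal eigenvectors, contradicting
  orthogonality. The mass near 0 is at most \<open>4 / h n\<close> because \<open>R n \<ge> 1 / 2\<close> there, and at least a
  multiple of \<open>1 / h n\<close> by testing against the kernel polynomial \<open>\<Sum>k\<le>n. h k * R k\<close>.
\<close>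

lemma exists_scaled_power_le:
  fixes q K l :: real
  assumes "0 \<le> q" "q < 1" "0 < l"
  shows "\<exists>n. K * q ^ n \<le> l"
proof -
  have "(\<lambda>n. K * q ^ n) \<longlonglongrightarrow> 0"
    using assms by (intro tendsto_mult_right_zero LIMSEQ_power_zero) auto
  then have "eventually (\<lambda>n. K * q ^ n < l) sequentially"
    using \<open>0 < l\<close> by (rule order_tendstoD)
  then show ?thesis
    by (auto simp: eventually_sequentially intro: less_imp_le)
qed

section \<open>Recurrence data with geometric bounds\<close>

text \<open>The asymptotics enter as bounds at every index, so that all later constants are uniform
  in \<open>n\<close>. \<open>h_Suc\<close> is the product formula for \<open>h\<close> in the form
  that symmetrizes the recurrence. In \<open>R_rec\<close> at \<open>n = 0\<close> the truncated
  index \<open>n - 1\<close> is harmless because \<open>\<alpha> 0 = 0\<close>.\<close>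

locale geometric_recurrence =
  fixes \<alpha> \<gamma> h :: "nat \<Rightarrow> real" and R :: "nat \<Rightarrow> real \<Rightarrow> real" and q s g B m C :: real
  assumes q: "0 < q" "q < 1" and s: "1 < s" and g: "0 < g" and m: "0 < m"
    and gamma_lower: "g * q ^ n \<le> \<gamma> n"
    and alpha_0: "\<alpha> 0 = 0"
    and alpha_pos: "0 < \<alpha> (Suc n)"
    and beta_upper: "\<alpha> n + \<gamma> n \<le> B * q ^ n"
    and h_0: "h 0 = 1"
    and h_Suc: "h (Suc n) * \<alpha> (Suc n) = \<gamma> n * h n"
    and h_lower: "m * s ^ n \<le> h n"
    and h_upper: "h n \<le> C * s ^ n"
    and R_0: "R 0 x = 1"
    and R_rec: "\<gamma> n * (R (Suc n) x - R n x) = \<alpha> n * (R n x - R (n - 1) x) - x * R n x"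
begin

definition P :: "nat \<Rightarrow> real \<Rightarrow> real" where "P n x = sqrt (h n) * R n x"

definition lam :: "nat \<Rightarrow> real" where "lam n = sqrt (\<alpha> (Suc n) * \<gamma> n)"

text \<open>\<open>D * h n\<close> dominates the partial sums of \<open>h\<close>. \<open>u n\<close> is a constant times \<open>q ^ (- n)\<close> with increments
  \<open>D / (g * q ^ n)\<close>, so that \<open>exp (u n * \<bar>x\<bar>)\<close> is a majorant for the recurrence. Above \<open>T * q ^ k\<close> the diagonal of
  the Jacobi matrix minus \<open>x\<close> dominates the off-diagonal entries from row \<open>k + 1\<close> on.\<close>

definition D :: real where "D = C * s / ((s - 1) * m)"

definition u :: "nat \<Rightarrow> real" where "u n = D / g * q / (1 - q) / q ^ n"

definition T :: real where "T = 5 * B"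

lemma gamma_pos: "0 < \<gamma> n"
  using gamma_lower[of n] q(1) g by (meson less_le_trans mult_pos_pos zero_less_power)

lemma alpha_nonneg: "0 \<le> \<alpha> n"
  using alpha_0 alpha_pos by (cases n) (auto simp: less_imp_le)

lemma h_pos: "0 < h n"
  using h_lower[of n] s m by (meson less_le_trans mult_pos_pos zero_less_power order.strict_trans zero_less_one)

lemma C_pos: "0 < C"
  using h_upper[of 0] h_pos[of 0] by simp

lemma B_pos: "0 < B"
  using beta_upper[of 0] gamma_pos[of 0] alpha_0 by simp

lemma T_pos: "0 < T"
  using B_pos by (simp add: T_def)

lemma D_pos: "0 < D"
  using C_pos s m by (simp add: D_def)

lemma u_pos: "0 < u n"
  using D_pos g q by (simp add: u_def)

lemma u_Suc: "u (Suc n) = u n + D / (g * q ^ n)"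
  using q g by (simp add: u_def divide_simps) (simp add: algebra_simps)

lemma u_mono: "n \<le> k \<Longrightarrow> u n \<le> u k"
  by (rule lift_Suc_mono_le[of u]) (use D_pos g q in \<open>auto simp: u_Suc\<close>)

section \<open>Summed recurrence and bounds for \<open>R\<close> near the origin\<close>

text \<open>Since \<open>s > 1\<close>, a geometric sum is dominated by its last term; passing from
  \<open>s ^ k\<close> to \<open>h k\<close> and back costs the factor \<open>C / m\<close> in
  \<open>D\<close>.\<close>

lemma h_sum_le: "(\<Sum>k\<le>n. h k) \<le> D * h n"
proof -
  have "(s - 1) * (\<Sum>k\<le>n. s ^ k) = s ^ Suc n - 1"
    using power_diff_1_eq[of s "Suc n"] by (simp add: lessThan_Suc_atMost)
  then have "(\<Sum>k\<le>n. s ^ k) \<le> s / (s - 1) * s ^ n"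
    using s by (simp add: field_simps)
  then have "C * (\<Sum>k\<le>n. s ^ k) \<le> C * (s / (s - 1) * s ^ n)"
    using C_pos by (intro mult_left_mono) auto
  also have "\<dots> = D * (m * s ^ n)"
    using m s by (simp add: D_def)
  also have "\<dots> \<le> D * h n"
    using D_pos h_lower by simp
  finally have "C * (\<Sum>k\<le>n. s ^ k) \<le> D * h n" .
  moreover have "(\<Sum>k\<le>n. h k) \<le> C * (\<Sum>k\<le>n. s ^ k)"
    by (simp add: sum_distrib_left sum_mono h_upper)
  ultimately show ?thesis by linarith
qed

lemma h_weighted_sum_le:
  assumes "\<And>k. k \<le> n \<Longrightarrow> \<bar>w k\<bar> \<le> M"
  shows "\<bar>\<Sum>k\<le>n. h k * w k\<bar> \<le> D * h n * M"
proof -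
  have "0 \<le> M" using assms[of 0] by simp
  have "\<bar>\<Sum>k\<le>n. h k * w k\<bar> \<le> (\<Sum>k\<le>n. \<bar>h k * w k\<bar>)"
    by (rule sum_abs)
  also have "\<dots> \<le> (\<Sum>k\<le>n. h k * M)"
    by (rule sum_mono) (use assms h_pos in \<open>simp add: abs_mult less_imp_le abs_of_pos\<close>)
  also have "\<dots> = (\<Sum>k\<le>n. h k) * M"
    by (simp add: sum_distrib_right)
  also have "\<dots> \<le> D * h n * M"
    using h_sum_le \<open>0 \<le> M\<close> by (simp add: mult_right_mono)
  finally show ?thesis .
qed

text \<open>Converts a bound on the summed recurrence into one on the increment \<open>y\<close> of
  \<open>R\<close>; the factor produced is exactly \<open>u (Suc n) - u n\<close>.\<close>

lemma abs_le_if_gamma_h_le: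
  assumes "\<bar>\<gamma> n * h n * y\<bar> \<le> D * h n * M" "0 \<le> M"
  shows "\<bar>y\<bar> \<le> D / (g * q ^ n) * M"
proof -
  have "h n * (\<gamma> n * \<bar>y\<bar>) \<le> h n * (D * M)"
    using assms gamma_pos[of n] h_pos[of n] by (simp add: abs_mult mult.assoc mult.commute mult.left_commute)
  then have "\<gamma> n * \<bar>y\<bar> \<le> D * M"
    using h_pos[of n] by simp
  moreover have "g * q ^ n * \<bar>y\<bar> \<le> \<gamma> n * \<bar>y\<bar>"
    using gamma_lower by (simp add: mult_right_mono)
  ultimately show ?thesis
    using g q by (simp add: field_simps)
qed

text \<open>After multiplication by \<open>h n\<close> the recurrence telescopes, because
  \<open>h_Suc\<close> identifies the incoming coefficient at \<open>n + 1\<close> with the outgoing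
  one at \<open>n\<close>.\<close>

lemma R_diff: "\<gamma> n * h n * (R (Suc n) x - R n x) = - x * (\<Sum>k\<le>n. h k * R k x)"
proof (induction n)
  case 0
  then show ?case using R_rec[of 0 x] by (simp add: h_0 alpha_0 R_0)
next
  case (Suc n)
  have "\<gamma> (Suc n) * h (Suc n) * (R (Suc (Suc n)) x - R (Suc n) x)
      = h (Suc n) * (\<gamma> (Suc n) * (R (Suc (Suc n)) x - R (Suc n) x))"
    by (simp add: algebra_simps)
  also have "\<dots> = h (Suc n) * \<alpha> (Suc n) * (R (Suc n) x - R n x) - x * (h (Suc n) * R (Suc n) x)"
    by (subst R_rec) (simp add: algebra_simps)
  also have "\<dots> = - x * (\<Sum>k\<le>Suc n. h k * R k x)"
    by (simp only: h_Suc Suc) (simp add: algebra_simps)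
  finally show ?case .
qed

text \<open>A discrete Gronwall argument: \<open>R_diff\<close> involves all earlier values, hence
  the strong induction, and \<open>1 + t \<le> exp t\<close> absorbs each increment into
  \<open>u\<close>.\<close>

lemma abs_R_minus_1_le: "\<bar>R n x - 1\<bar> \<le> exp (u n * \<bar>x\<bar>) - 1"
proof (induction n rule: less_induct)
  case (less n)
  show ?case
  proof (cases n)
    case 0
    then show ?thesis using u_pos[of 0] by (simp add: R_0)
  next
    case (Suc k)
    let ?e = "exp (u k * \<bar>x\<bar>)" and ?d = "D / (g * q ^ k)"
    have R: "\<bar>R j x\<bar> \<le> ?e" if "j \<le> k" for j
    proof -
      have "u j * \<bar>x\<bar> \<le> u k * \<bar>x\<bar>"
        using u_mono[OF that] by (simp add: mult_right_mono)
      then have "exp (u j * \<bar>x\<bar>) \<le> ?e"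
        by simp
      then show ?thesis
        using less.IH[of j] that Suc by linarith
    qed
    have "\<bar>\<gamma> k * h k * (R (Suc k) x - R k x)\<bar> \<le> D * h k * (\<bar>x\<bar> * ?e)"
      unfolding R_diff using mult_left_mono[OF h_weighted_sum_le[of k "\<lambda>k. R k x" ?e, OF R], of "\<bar>x\<bar>"]
      by (simp add: abs_mult algebra_simps)
    then have 1: "\<bar>R (Suc k) x - R k x\<bar> \<le> ?d * (\<bar>x\<bar> * ?e)"
      by (rule abs_le_if_gamma_h_le) simp
    have 2: "\<bar>R k x - 1\<bar> \<le> ?e - 1"
      using less.IH Suc by simp
    have "\<bar>R (Suc k) x - 1\<bar> \<le> ?e * (1 + ?d * \<bar>x\<bar>) - 1"
      using 1 2 by (simp add: algebra_simps)
    also have "\<dots> \<le> ?e * exp (?d * \<bar>x\<bar>) - 1"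
      using exp_ge_add_one_self[of "?d * \<bar>x\<bar>"] by simp
    also have "\<dots> = exp (u (Suc k) * \<bar>x\<bar>) - 1"
      by (simp add: u_Suc algebra_simps flip: exp_add)
    finally show ?thesis using Suc by simp
  qed
qed

lemma abs_R_le: "\<bar>R n x\<bar> \<le> exp (u n * \<bar>x\<bar>)"
  using abs_R_minus_1_le[of n x] by linarith

lemma exp_u_mono: "k \<le> n \<Longrightarrow> \<bar>x\<bar> \<le> X \<Longrightarrow> exp (u k * \<bar>x\<bar>) \<le> exp (u n * X)"
  using u_mono[of k n] u_pos[of k] by (simp add: mult_mono)

text \<open>The same Gronwall argument for the difference of two solutions. The constant is the
  derivative in \<open>X\<close> of the majorant \<open>exp (u n * X)\<close>.\<close>

lemma R_lipschitz:
  assumes "\<bar>x\<bar> \<le> X" "\<bar>y\<bar> \<le> X"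
  shows "\<bar>R n x - R n y\<bar> \<le> u n * exp (u n * X) * \<bar>x - y\<bar>"
proof (induction n rule: less_induct)
  case (less n)
  show ?case
  proof (cases n)
    case 0
    then show ?thesis using u_pos[of 0] by (simp add: R_0)
  next
    case (Suc k)
    let ?e = "exp (u k * X)" and ?d = "D / (g * q ^ k)"
    have X: "0 \<le> X" using assms by linarith
    have d: "0 \<le> ?d" using D_pos g q by simp
    define r where "r j = R j x - R j y" for j
    have r: "\<bar>r j\<bar> \<le> u k * ?e * \<bar>x - y\<bar>" if "j \<le> k" for j
    proof -
      have "u j * exp (u j * X) \<le> u k * ?e"
        using u_mono[OF that] u_pos[of j] X by (intro mult_mono) (auto simp: mult_right_mono)
      then have "u j * exp (u j * X) * \<bar>x - y\<bar> \<le> u k * ?e * \<bar>x - y\<bar>"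
        by (rule mult_right_mono) simp
      then show ?thesis
        using less.IH[of j] that Suc unfolding r_def by linarith
    qed
    have R: "\<bar>R j y\<bar> \<le> ?e" if "j \<le> k" for j
      using abs_R_le[of j y] exp_u_mono[OF that assms(2)] by linarith
    have "\<gamma> k * h k * (r (Suc k) - r k)
        = - (x * (\<Sum>k\<le>k. h k * r k) + (x - y) * (\<Sum>k\<le>k. h k * R k y))"
      using R_diff[of k x] R_diff[of k y] unfolding r_def
      by (simp add: algebra_simps sum_subtractf)
    moreover have "\<bar>x * (\<Sum>k\<le>k. h k * r k)\<bar> \<le> X * (D * h k * (u k * ?e * \<bar>x - y\<bar>))"
      unfolding abs_mult by (rule mult_mono[OF assms(1) h_weighted_sum_le[OF r]]) (use X in auto)
    moreover have "\<bar>(x - y) * (\<Sum>k\<le>k. h k * R k y)\<bar> \<le> \<bar>x - y\<bar> * (D * h k * ?e)"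
      unfolding abs_mult by (rule mult_left_mono[OF h_weighted_sum_le[OF R]]) auto
    ultimately have "\<bar>\<gamma> k * h k * (r (Suc k) - r k)\<bar> \<le> D * h k * ((X * u k + 1) * ?e * \<bar>x - y\<bar>)"
      by (simp add: algebra_simps)
    then have 1: "\<bar>r (Suc k) - r k\<bar> \<le> ?d * ((X * u k + 1) * ?e * \<bar>x - y\<bar>)"
      by (rule abs_le_if_gamma_h_le) (use X u_pos[of k] in simp)
    have "\<bar>r (Suc k)\<bar> \<le> (u k + ?d * (X * u k + 1)) * (?e * \<bar>x - y\<bar>)"
      using 1 r[of k] by (simp add: algebra_simps)
    also have "\<dots> \<le> ((u k + ?d) * exp (?d * X)) * (?e * \<bar>x - y\<bar>)"
    proof (rule mult_right_mono)
      \<comment> \<open>The two sides differ by \<open>?d * ?d * X\<close>.\<close>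
      have "u k + ?d * (X * u k + 1) \<le> (u k + ?d) * (1 + ?d * X)"
        using mult_nonneg_nonneg[OF mult_nonneg_nonneg[OF d d] X] by (simp only: algebra_simps)
      also have "\<dots> \<le> (u k + ?d) * exp (?d * X)"
        using exp_ge_add_one_self[of "?d * X"] d u_pos[of k] by (intro mult_left_mono) auto
      finally show "u k + ?d * (X * u k + 1) \<le> (u k + ?d) * exp (?d * X)" .
    qed simp
    also have "\<dots> = u (Suc k) * exp (u (Suc k) * X) * \<bar>x - y\<bar>"
      by (simp add: u_Suc algebra_simps flip: exp_add)
    finally show ?thesis using Suc unfolding r_def by simp
  qed
qed

text \<open>For \<open>x \<le> 0\<close> the right side of \<open>R_diff\<close> is nonnegative, so
  \<open>R n x\<close> increases with \<open>n\<close>. This will exclude mass on the nonpositive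
  axis.\<close>

lemma R_ge_1: "x \<le> 0 \<Longrightarrow> 1 \<le> R n x"
proof (induction n rule: less_induct)
  case (less n)
  show ?case
  proof (cases n)
    case 0
    then show ?thesis by (simp add: R_0)
  next
    case (Suc k)
    have "0 \<le> h j * R j x" if "j \<le> k" for j
      using less.IH[of j] less.prems that Suc h_pos[of j] by simp
    then have "0 \<le> (\<Sum>j\<le>k. h j * R j x)"
      by (intro sum_nonneg) auto
    then have "0 \<le> \<gamma> k * h k * (R (Suc k) x - R k x)"
      unfolding R_diff using less.prems by (simp add: mult_nonpos_nonneg)
    then have "R k x \<le> R (Suc k) x"
      using mult_pos_pos[OF gamma_pos[of k] h_pos[of k]] by (simp add: zero_le_mult_iff)
    then show ?thesis using less.IH[of k] less.prems Suc by simp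
  qed
qed

section \<open>The symmetric Jacobi matrix\<close>

lemma lam_pos: "0 < lam n"
  using alpha_pos gamma_pos by (simp add: lam_def)

lemma gamma_le: "\<gamma> n \<le> B * q ^ n"
  using beta_upper[of n] alpha_nonneg[of n] by simp

lemma lam_le: "lam n \<le> B * q ^ n"
proof -
  have "\<alpha> (Suc n) \<le> B * q ^ Suc n"
    using beta_upper[of "Suc n"] gamma_pos[of "Suc n"] by simp
  also have "\<dots> \<le> B * q ^ n"
    using B_pos q by (simp add: power_decreasing mult_left_le)
  finally have "\<alpha> (Suc n) * \<gamma> n \<le> (B * q ^ n) * (B * q ^ n)"
    using gamma_le[of n] gamma_pos[of n] alpha_pos[of n] B_pos q by (intro mult_mono) auto
  then show ?thesis
    unfolding lam_def by (intro real_le_lsqrt) (use B_pos q in \<open>auto simp: power2_eq_square\<close>)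
qed

text \<open>Both follow from \<open>h_Suc\<close> under the square root. They conjugate the
  recurrence of \<open>R\<close> into the symmetric one of \<open>P\<close>.\<close>

lemma lam_h:
  "lam n * sqrt (h (Suc n)) = \<gamma> n * sqrt (h n)"
  "lam n * sqrt (h n) = \<alpha> (Suc n) * sqrt (h (Suc n))"
proof -
  have "lam n * sqrt (h (Suc n)) = sqrt (\<gamma> n * (h (Suc n) * \<alpha> (Suc n)))"
    by (simp add: lam_def algebra_simps flip: real_sqrt_mult)
  also have "\<dots> = sqrt ((\<gamma> n)\<^sup>2 * h n)"
    unfolding h_Suc by (simp add: power2_eq_square algebra_simps)
  finally show "lam n * sqrt (h (Suc n)) = \<gamma> n * sqrt (h n)"
    using gamma_pos[of n] by (simp add: real_sqrt_mult)
  have "lam n * sqrt (h n) = sqrt (\<alpha> (Suc n) * (\<gamma> n * h n))"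
    by (simp add: lam_def algebra_simps flip: real_sqrt_mult)
  also have "\<dots> = sqrt ((\<alpha> (Suc n))\<^sup>2 * h (Suc n))"
    using h_Suc[of n] by (simp add: power2_eq_square algebra_simps)
  finally show "lam n * sqrt (h n) = \<alpha> (Suc n) * sqrt (h (Suc n))"
    using alpha_pos[of n] by (simp add: real_sqrt_mult)
qed

lemma P_rec:
  "x * P n x = (\<alpha> n + \<gamma> n) * P n x - lam n * P (Suc n) x
     - (if n = 0 then 0 else lam (n - 1) * P (n - 1) x)"
proof -
  have 1: "lam n * P (Suc n) x = \<gamma> n * R (Suc n) x * sqrt (h n)"
    unfolding P_def using lam_h(1)[of n] by (simp add: algebra_simps)
  have 2: "(if n = 0 then 0 else lam (n - 1) * P (n - 1) x) = \<alpha> n * R (n - 1) x * sqrt (h n)"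
    unfolding P_def using lam_h(2)[of "n - 1"] by (cases n) (simp_all add: alpha_0 algebra_simps)
  have "x * R n x = (\<alpha> n + \<gamma> n) * R n x - \<gamma> n * R (Suc n) x - \<alpha> n * R (n - 1) x"
    using R_rec[of n x] by (simp add: algebra_simps)
  then have "sqrt (h n) * (x * R n x) =
      sqrt (h n) * ((\<alpha> n + \<gamma> n) * R n x - \<gamma> n * R (Suc n) x - \<alpha> n * R (n - 1) x)"
    by simp
  then show ?thesis
    unfolding 1 2 by (simp add: P_def algebra_simps)
qed

lemma P_0: "P 0 x = 1"
  by (simp add: P_def h_0 R_0)

section \<open>Growth or decay of \<open>P k x\<close> above the scale of row
  \<open>k\<close>\<close>

text \<open>The diagonal entry, twice \<open>lam (Suc k)\<close> and twice \<open>lam k\<close> are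
  together at most \<open>5 * B * q ^ k\<close>, which is where \<open>T\<close> comes from. So the
  term \<open>x * P (Suc k) x\<close> outweighs the rest of the recurrence and forces a
  doubling.\<close>

lemma P_step:
  assumes "T * q ^ k \<le> x" "\<bar>P k x\<bar> \<le> 2 * \<bar>P (Suc k) x\<bar>"
  shows "2 * \<bar>P (Suc k) x\<bar> \<le> \<bar>P (Suc (Suc k)) x\<bar>"
proof -
  have qk: "B * q ^ Suc k \<le> B * q ^ k"
    using B_pos q by (simp add: mult_left_le)
  have 1: "2 * lam (Suc k) + 2 * lam k + (\<alpha> (Suc k) + \<gamma> (Suc k)) \<le> x"
    using beta_upper[of "Suc k"] lam_le[of "Suc k"] lam_le[of k] qk assms(1) unfolding T_def by simp
  have "lam (Suc k) * (2 * \<bar>P (Suc k) x\<bar>) \<le> (x - (\<alpha> (Suc k) + \<gamma> (Suc k))) * \<bar>P (Suc k) x\<bar> - lam k * (2 * \<bar>P (Suc k) x\<bar>)"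
    using mult_right_mono[OF 1, of "\<bar>P (Suc k) x\<bar>"] by (simp add: algebra_simps)
  also have "\<dots> \<le> (x - (\<alpha> (Suc k) + \<gamma> (Suc k))) * \<bar>P (Suc k) x\<bar> - lam k * \<bar>P k x\<bar>"
    using assms(2) lam_pos[of k] by simp
  also have "\<dots> \<le> \<bar>lam (Suc k) * P (Suc (Suc k)) x\<bar>"
  proof -
    have "(x - (\<alpha> (Suc k) + \<gamma> (Suc k))) * P (Suc k) x = - (lam (Suc k) * P (Suc (Suc k)) x) - lam k * P k x"
      using P_rec[of x "Suc k"] by (simp add: algebra_simps)
    moreover have "0 \<le> x - (\<alpha> (Suc k) + \<gamma> (Suc k))"
      using 1 lam_pos[of "Suc k"] lam_pos[of k] by simp
    then have "(x - (\<alpha> (Suc k) + \<gamma> (Suc k))) * \<bar>P (Suc k) x\<bar> = \<bar>(x - (\<alpha> (Suc k) + \<gamma> (Suc k))) * P (Suc k) x\<bar>"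
      by (simp add: abs_mult)
    moreover have "lam k * \<bar>P k x\<bar> = \<bar>lam k * P k x\<bar>"
      using lam_pos[of k] by (simp add: abs_mult)
    ultimately show ?thesis by linarith
  qed
  also have "\<dots> = lam (Suc k) * \<bar>P (Suc (Suc k)) x\<bar>"
    using lam_pos[of "Suc k"] by (simp add: abs_mult)
  finally show ?thesis
    using lam_pos[of "Suc k"] by simp
qed

text \<open>The conclusion of \<open>P_step\<close> gives its own hypothesis at the next index, so
  one failure of halving starts growth that never stops; the induction carries that hypothesis
  along.\<close>

lemma P_growth:
  assumes "T * q ^ k \<le> x" "\<bar>P k x\<bar> < 2 * \<bar>P (Suc k) x\<bar>"
  shows "2 ^ j * \<bar>P (Suc k) x\<bar> \<le> \<bar>P (Suc k + j) x\<bar>"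
proof -
  have "2 ^ j * \<bar>P (Suc k) x\<bar> \<le> \<bar>P (Suc k + j) x\<bar> \<and> \<bar>P (k + j) x\<bar> \<le> 2 * \<bar>P (Suc k + j) x\<bar>"
  proof (induction j)
    case 0
    then show ?case using assms by simp
  next
    case (Suc j)
    have "T * q ^ (k + j) \<le> T * q ^ k"
      using T_pos q by (intro mult_left_mono power_decreasing) auto
    then have "2 * \<bar>P (Suc (k + j)) x\<bar> \<le> \<bar>P (Suc (Suc (k + j))) x\<bar>"
      using Suc assms by (intro P_step) auto
    then show ?case using Suc by simp
  qed
  then show ?thesis by simp
qed

text \<open>The candidate eigenvalues. Requiring halving at every row below the scale of
  \<open>x\<close> is an explicit substitute for square-summability of \<open>P k x\<close> in
  \<open>k\<close>: by \<open>P_growth\<close> the alternative is exponential growth.\<close>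

definition spec :: "real set" where
  "spec = {x. 0 < x \<and> (\<forall>k. T * q ^ k \<le> x \<longrightarrow> 2 * \<bar>P (Suc k) x\<bar> \<le> \<bar>P k x\<bar>)}"

lemma spec_decay:
  assumes "x \<in> spec" "T * q ^ n \<le> x"
  shows "\<bar>P (n + j) x\<bar> \<le> \<bar>P n x\<bar> * (1 / 2) ^ j"
proof (induction j)
  case (Suc j)
  have "T * q ^ (n + j) \<le> T * q ^ n"
    using T_pos q by (intro mult_left_mono power_decreasing) auto
  then have "2 * \<bar>P (Suc (n + j)) x\<bar> \<le> \<bar>P (n + j) x\<bar>"
    using assms by (auto simp: spec_def)
  then show ?case using Suc by simp
qed simp

lemma exists_q_power_le: "0 < l \<Longrightarrow> \<exists>n. K * q ^ n \<le> l"
  using exists_scaled_power_le q by simp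

text \<open>Halving is only guaranteed once \<open>T * q ^ n \<le> x\<close>; the finitely many
  earlier rows are absorbed in \<open>K\<close>.\<close>

lemma spec_bound:
  assumes "x \<in> spec"
  obtains K where "\<And>k. \<bar>P k x\<bar> \<le> K * (1 / 2) ^ k"
proof -
  obtain n where n: "T * q ^ n \<le> x"
    using exists_q_power_le[of x T] assms by (auto simp: spec_def)
  define K where "K = (\<Sum>k\<le>n. \<bar>P k x\<bar> * 2 ^ n)"
  have K: "\<bar>P k x\<bar> * 2 ^ n \<le> K" if "k \<le> n" for k
    unfolding K_def by (rule member_le_sum) (use that in auto)
  have "\<bar>P k x\<bar> \<le> K * (1 / 2) ^ k" for k
  proof (cases "k \<le> n")
    case True
    have "\<bar>P k x\<bar> * 2 ^ k \<le> \<bar>P k x\<bar> * 2 ^ n"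
      using True by (intro mult_left_mono power_increasing) auto
    also have "\<dots> \<le> K" using K True by simp
    finally show ?thesis by (simp add: field_simps)
  next
    case False
    then obtain j where j: "k = n + j" using le_Suc_ex nat_le_linear by blast
    have "\<bar>P k x\<bar> \<le> \<bar>P n x\<bar> * (1 / 2) ^ j"
      using spec_decay[OF assms n] j by simp
    also have "\<dots> = (\<bar>P n x\<bar> * 2 ^ n) * (1 / 2) ^ k"
      by (simp add: j power_add field_simps)
    also have "\<dots> \<le> K * (1 / 2) ^ k"
      using K[of n] by (intro mult_right_mono) auto
    finally show ?thesis .
  qed
  then show ?thesis using that by blast
qed

lemma spec_prod_bound:
  assumes "x \<in> spec" "y \<in> spec"
  obtains K where "\<And>i j. \<bar>P i x * P j y\<bar> \<le> K * ((1 / 2) ^ i * (1 / 2) ^ j)"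
proof -
  obtain K where K: "\<And>k. \<bar>P k x\<bar> \<le> K * (1 / 2) ^ k" using spec_bound[OF assms(1)] by blast
  obtain L where L: "\<And>k. \<bar>P k y\<bar> \<le> L * (1 / 2) ^ k" using spec_bound[OF assms(2)] by blast
  have "\<bar>P i x * P j y\<bar> \<le> (K * L) * ((1 / 2) ^ i * (1 / 2) ^ j)" for i j
  proof -
    have "\<bar>P i x\<bar> * \<bar>P j y\<bar> \<le> (K * (1 / 2) ^ i) * (L * (1 / 2) ^ j)"
      by (intro mult_mono K L) (use order_trans[OF abs_ge_zero K[of i]] in auto)
    then show ?thesis by (simp add: abs_mult algebra_simps)
  qed
  then show ?thesis using that by blast
qed

lemma spec_summable:
  assumes "x \<in> spec" "y \<in> spec"
  shows "summable (\<lambda>k. P k x * P k y)"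
proof -
  obtain K where K: "\<And>i j. \<bar>P i x * P j y\<bar> \<le> K * ((1 / 2) ^ i * (1 / 2) ^ j)"
    using spec_prod_bound[OF assms] by blast
  have "summable (\<lambda>k. K * (1 / 4 :: real) ^ k)"
    by (intro summable_mult summable_geometric) auto
  moreover have "norm (P k x * P k y) \<le> K * (1 / 4) ^ k" for k
    using K[of k k] by (simp flip: power_mult_distrib)
  ultimately show ?thesis
    by (rule summable_comparison_test')
qed

text \<open>The recurrences at \<open>x\<close> and \<open>y\<close> telescope. The sign is opposite
  to the usual form because the off-diagonal entries are \<open>- lam n\<close>.\<close>

lemma christoffel_darboux:
  "(x - y) * (\<Sum>k<Suc n. P k x * P k y) = lam n * (P n x * P (Suc n) y - P (Suc n) x * P n y)"
proof (induction n)
  case 0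
  have "x * 1 = (\<alpha> 0 + \<gamma> 0) * 1 - lam 0 * P (Suc 0) x" "y * 1 = (\<alpha> 0 + \<gamma> 0) * 1 - lam 0 * P (Suc 0) y"
    using P_rec[of x 0] P_rec[of y 0] by (simp_all add: P_0)
  then show ?case by (simp add: P_0 algebra_simps)
next
  case (Suc n)
  have x: "x * P (Suc n) x = (\<alpha> (Suc n) + \<gamma> (Suc n)) * P (Suc n) x - lam (Suc n) * P (Suc (Suc n)) x - lam n * P n x"
    and y: "y * P (Suc n) y = (\<alpha> (Suc n) + \<gamma> (Suc n)) * P (Suc n) y - lam (Suc n) * P (Suc (Suc n)) y - lam n * P n y"
    using P_rec[of _ "Suc n"] by simp_all
  have "(x - y) * (\<Sum>k<Suc (Suc n). P k x * P k y)
      = lam n * (P n x * P (Suc n) y - P (Suc n) x * P n y) + (x * P (Suc n) x) * P (Suc n) y - (y * P (Suc n) y) * P (Suc n) x"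
    by (subst sum.lessThan_Suc, subst distrib_left, subst Suc) (simp add: algebra_simps)
  also have "\<dots> = lam (Suc n) * (P (Suc n) x * P (Suc (Suc n)) y - P (Suc (Suc n)) x * P (Suc n) y)"
    unfolding x y by (simp add: algebra_simps)
  finally show ?case .
qed

text \<open>Eigenvectors for different eigenvalues: the boundary term of
  \<open>christoffel_darboux\<close> tends to 0, as \<open>lam\<close> is bounded and
  \<open>P\<close> decays at both points.\<close>

lemma spec_orthogonal:
  assumes "x \<in> spec" "y \<in> spec" "x \<noteq> y"
  shows "(\<lambda>k. P k x * P k y) sums 0"
proof -
  obtain K where K: "\<And>i j. \<bar>P i x * P j y\<bar> \<le> K * ((1 / 2) ^ i * (1 / 2) ^ j)"
    using spec_prod_bound[OF assms(1,2)] by blast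
  have K0: "0 \<le> K" using order_trans[OF abs_ge_zero K[of 0 0]] by simp
  have K': "\<bar>P i x * P j y\<bar> \<le> K * (1 / 2) ^ n" if "n \<le> i" "n \<le> j" for i j n
  proof -
    have "(1 / 2 :: real) ^ i * (1 / 2) ^ j \<le> (1 / 2) ^ n * 1"
      using that by (intro mult_mono power_decreasing power_le_one) auto
    then have "K * ((1 / 2) ^ i * (1 / 2) ^ j) \<le> K * (1 / 2) ^ n"
      using K0 by (simp add: mult_left_mono)
    then show ?thesis using K[of i j] by linarith
  qed
  have "(\<lambda>n. (x - y) * (\<Sum>k<Suc n. P k x * P k y)) \<longlonglongrightarrow> 0"
  proof (rule Lim_null_comparison)
    show "(\<lambda>n. B * (K * 2) * (1 / 2 :: real) ^ n) \<longlonglongrightarrow> 0"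
      by (rule tendsto_mult_right_zero) (rule LIMSEQ_power_zero, simp)
    have "norm ((x - y) * (\<Sum>k<Suc n. P k x * P k y)) \<le> B * (K * 2) * (1 / 2) ^ n" for n
    proof -
      have "lam n \<le> B" using lam_le[of n] B_pos q by (meson mult_left_le order_trans power_le_one less_imp_le)
      moreover have "\<bar>P n x * P (Suc n) y - P (Suc n) x * P n y\<bar> \<le> K * 2 * (1 / 2) ^ n"
        using K'[of n n "Suc n"] K'[of n "Suc n" n] by linarith
      ultimately have "lam n * \<bar>P n x * P (Suc n) y - P (Suc n) x * P n y\<bar> \<le> B * (K * 2 * (1 / 2) ^ n)"
        using lam_pos[of n] B_pos by (intro mult_mono) auto
      then show ?thesis
        unfolding christoffel_darboux using lam_pos[of n] by (simp add: abs_mult)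
    qed
    then show "\<forall>\<^sub>F n in sequentially. norm ((x - y) * (\<Sum>k<Suc n. P k x * P k y)) \<le> B * (K * 2) * (1 / 2) ^ n"
      by simp
  qed
  then have "(\<lambda>n. inverse (x - y) * ((x - y) * (\<Sum>k<Suc n. P k x * P k y))) \<longlonglongrightarrow> inverse (x - y) * 0"
    by (intro tendsto_mult tendsto_const)
  then have "(\<lambda>n. \<Sum>k<Suc n. P k x * P k y) \<longlonglongrightarrow> 0"
    using assms(3) by simp
  then show ?thesis
    unfolding sums_def by (rule LIMSEQ_imp_Suc)
qed

end

section \<open>Upper bound for the eigenvalues by a min-max argument\<close>

text \<open>More unknowns than homogeneous equations. One step of Gaussian elimination removes the
  last equation together with a pivot unknown \<open>j\<close>.\<close>

lemma exists_nontrivial_relation: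
  fixes f :: "nat \<Rightarrow> 'a \<Rightarrow> real"
  assumes "finite S" "n < card S"
  shows "\<exists>c. (\<exists>i\<in>S. c i \<noteq> 0) \<and> (\<forall>k<n. (\<Sum>i\<in>S. c i * f k i) = 0)"
  using assms
proof (induction n arbitrary: S f)
  case 0
  then have "S \<noteq> {}" by auto
  then show ?case by (intro exI[of _ "\<lambda>_. 1"]) auto
next
  case (Suc n)
  show ?case
  proof (cases "\<forall>i\<in>S. f n i = 0")
    case True
    obtain c where "\<exists>i\<in>S. c i \<noteq> 0" "\<forall>k<n. (\<Sum>i\<in>S. c i * f k i) = 0"
      using Suc.IH[of S f] Suc.prems by auto
    then show ?thesis using True by (intro exI[of _ c]) (auto simp: less_Suc_eq)
  next
    case False
    then obtain j where j: "j \<in> S" "f n j \<noteq> 0" by auto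
    define S' where "S' = S - {j}"
    define f' where "f' k i = f k i - f k j * f n i / f n j" for k i
    have S': "finite S'" "n < card S'" "j \<notin> S'" "S = insert j S'"
      using Suc.prems j by (auto simp: S'_def)
    obtain c where c: "\<exists>i\<in>S'. c i \<noteq> 0" "\<And>k. k < n \<Longrightarrow> (\<Sum>i\<in>S'. c i * f' k i) = 0"
      using Suc.IH[of S' f'] S' by auto
    define c' where "c' = c(j := - (\<Sum>i\<in>S'. c i * f n i) / f n j)"
    have c': "(\<Sum>i\<in>S. c' i * f k i) = (\<Sum>i\<in>S'. c i * f' k i)" for k
    proof -
      have "(\<Sum>i\<in>S'. c' i * f k i) = (\<Sum>i\<in>S'. c i * f k i)"
        using S' by (intro sum.cong) (auto simp: c'_def)
      then have "(\<Sum>i\<in>S. c' i * f k i) = c' j * f k j + (\<Sum>i\<in>S'. c i * f k i)"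
        using S' by simp
      also have "\<dots> = (\<Sum>i\<in>S'. c i * f' k i)"
        by (simp add: c'_def f'_def algebra_simps sum_subtractf sum_divide_distrib sum_distrib_left)
      finally show ?thesis .
    qed
    have "(\<Sum>i\<in>S. c' i * f k i) = 0" if "k < Suc n" for k
      using that c(2)[of k] j by (cases "k = n") (auto simp: c' f'_def)
    moreover have "\<exists>i\<in>S. c' i \<noteq> 0"
      using c(1) S' by (auto simp: c'_def)
    ultimately show ?thesis by blast
  qed
qed

context geometric_recurrence
begin

text \<open>Some nonzero combination \<open>v\<close> of the eigenvectors vanishes in its first
  \<open>n\<close> coordinates. Orthogonality bounds its quadratic form below by
  \<open>t * V\<close>, while the size of the remaining matrix entries bounds it above by
  \<open>T * q ^ n * V\<close>.\<close>

lemma spec_count_upper: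
  assumes S: "finite S" "S \<subseteq> spec" "\<And>x. x \<in> S \<Longrightarrow> t \<le> x" and card: "n < card S"
  shows "t \<le> T * q ^ n"
proof -
  obtain c where c: "\<exists>i\<in>S. c i \<noteq> 0" and "\<And>k. k < n \<Longrightarrow> (\<Sum>i\<in>S. c i * P k i) = 0"
    using exists_nontrivial_relation[OF S(1) card, of P] by blast
  define v where "v k = (\<Sum>i\<in>S. c i * P k i)" for k
  \<comment> \<open>\<open>w\<close> is the image of \<open>v\<close> under the Jacobi matrix,
    \<open>v'\<close> is \<open>v\<close> shifted by one with 0 put in front, and \<open>V\<close>
    is the squared norm of \<open>v\<close>.\<close>
  define w where "w k = (\<Sum>i\<in>S. c i * i * P k i)" for k
  define v' where "v' k = (if k = 0 then 0 else v (k - 1))" for k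
  define N where "N i = (\<Sum>k. P k i * P k i)" for i
  define V where "V = (\<Sum>i\<in>S. (c i)\<^sup>2 * N i)"
  have v0: "v k = 0" if "k < n" for k
    using that \<open>\<And>k. k < n \<Longrightarrow> (\<Sum>i\<in>S. c i * P k i) = 0\<close> by (simp add: v_def)
  have sums: "(\<lambda>k. P k i * P k j) sums (if i = j then N i else 0)" if "i \<in> S" "j \<in> S" for i j
    using that S(2) spec_orthogonal[of i j] summable_sums[OF spec_summable[of i i]] by (auto simp: N_def)
  have bilinear: "(\<lambda>k. (\<Sum>i\<in>S. c i * P k i) * (\<Sum>j\<in>S. d j * P k j)) sums (\<Sum>i\<in>S. c i * d i * N i)" for d
  proof -
    have "(\<lambda>k. \<Sum>i\<in>S. \<Sum>j\<in>S. c i * d j * (P k i * P k j)) sums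
        (\<Sum>i\<in>S. \<Sum>j\<in>S. c i * d j * (if i = j then N i else 0))"
      by (intro sums_sum sums_mult sums)
    moreover have "(\<Sum>i\<in>S. \<Sum>j\<in>S. c i * d j * (if i = j then N i else 0)) = (\<Sum>i\<in>S. c i * d i * N i)"
      using S(1) by (intro sum.cong) (auto simp: if_distrib cong: if_cong)
    ultimately show ?thesis
      by (simp add: sum_product algebra_simps)
  qed
  have vv: "(\<lambda>k. v k * v k) sums V"
    using bilinear[of c] by (simp add: v_def V_def power2_eq_square)
  have vw: "(\<lambda>k. v k * w k) sums (\<Sum>i\<in>S. c i * (c i * i) * N i)"
    using bilinear[of "\<lambda>i. c i * i"] by (simp add: v_def w_def)
  have vSuc: "(\<lambda>k. v (Suc k) * v (Suc k)) sums (V - v 0 * v 0)"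
    using vv by (subst sums_Suc_iff) simp
  have vPred: "(\<lambda>k. v' k * v' k) sums V"
    using sums_Suc[of "\<lambda>k. v' k * v' k" V] vv by (simp add: v'_def)
  have N_ge: "1 \<le> N i" if "i \<in> S" for i
  proof -
    have "(\<Sum>k\<in>{0}. P k i * P k i) \<le> N i"
      unfolding N_def using that S(2) by (intro sum_le_suminf spec_summable) auto
    then show ?thesis by (simp add: P_0)
  qed
  have V_pos: "0 < V"
  proof -
    obtain i where i: "i \<in> S" "c i \<noteq> 0" using c by blast
    have "0 < (c i)\<^sup>2 * N i" using i N_ge[of i] by simp
    also have "\<dots> \<le> V"
      unfolding V_def by (rule member_le_sum) (use i N_ge S(1) in \<open>auto intro!: mult_nonneg_nonneg simp: order_trans[OF zero_le_one]\<close>)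
    finally show ?thesis .
  qed
  have w: "w k = (\<alpha> k + \<gamma> k) * v k - lam k * v (Suc k) - lam (k - 1) * v' k" for k
  proof -
    have "w k = (\<Sum>i\<in>S. c i * ((\<alpha> k + \<gamma> k) * P k i - lam k * P (Suc k) i - (if k = 0 then 0 else lam (k - 1) * P (k - 1) i)))"
      unfolding w_def by (intro sum.cong refl) (simp only: mult.assoc P_rec)
    also have "\<dots> = (\<alpha> k + \<gamma> k) * v k - lam k * v (Suc k) - lam (k - 1) * v' k"
      by (simp add: v_def v'_def sum_subtractf sum_distrib_left right_diff_distrib mult.left_commute)
    finally show ?thesis .
  qed
  define b where "b = B * q ^ n"
  have b: "0 < b" using B_pos q by (simp add: b_def)
  have q_mono: "B * q ^ k \<le> b" if "n \<le> k" for k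
    unfolding b_def using that B_pos q by (intro mult_left_mono power_decreasing) auto
  \<comment> \<open>Expanding \<open>0 \<le> l * (y + z)^2\<close> gives the bound with
    \<open>l\<close>, which is then enlarged to \<open>b\<close>.\<close>
  have cross: "- (l * y * z) \<le> b * ((y * y + z * z) / 2)" if "0 \<le> l" "l \<le> b" for l y z :: real
  proof -
    have "0 \<le> l * ((y + z) * (y + z))"
      using that by simp
    then have "- (l * y * z) \<le> l * ((y * y + z * z) / 2)"
      by (simp add: algebra_simps)
    also have "\<dots> \<le> b * ((y * y + z * z) / 2)"
      using that by (intro mult_right_mono) auto
    finally show ?thesis .
  qed
  have vw_le: "v k * w k \<le> b * (v k * v k) + b * ((v k * v k + v (Suc k) * v (Suc k)) / 2) + b * ((v k * v k + v' k * v' k) / 2)" for k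
  proof (cases "k < n")
    case True
    then show ?thesis using b by (simp add: v0)
  next
    case False
    have 1: "(\<alpha> k + \<gamma> k) * (v k * v k) \<le> b * (v k * v k)"
      using order_trans[OF beta_upper[of k] q_mono[of k]] False by (intro mult_right_mono) auto
    have 2: "- (lam k * v k * v (Suc k)) \<le> b * ((v k * v k + v (Suc k) * v (Suc k)) / 2)"
      using order_trans[OF lam_le[of k] q_mono[of k]] False lam_pos[of k] by (intro cross) auto
    \<comment> \<open>At \<open>k = n > 0\<close> the coefficient \<open>lam (n - 1)\<close> need
      not be below \<open>b\<close>, but it multiplies \<open>v (n - 1) = 0\<close>.\<close>
    have 3: "- (lam (k - 1) * v k * v' k) \<le> b * ((v k * v k + v' k * v' k) / 2)"
    proof (cases "n \<le> k - 1")
      case True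
      then show ?thesis
        using order_trans[OF lam_le[of "k - 1"] q_mono[of "k - 1"]] lam_pos[of "k - 1"] by (intro cross) auto
    next
      case False
      then have "v' k = 0" by (simp add: v'_def v0)
      then show ?thesis using b by simp
    qed
    have "v k * w k = (\<alpha> k + \<gamma> k) * (v k * v k) + - (lam k * v k * v (Suc k)) + - (lam (k - 1) * v k * v' k)"
      unfolding w by (simp add: algebra_simps)
    then show ?thesis using 1 2 3 by linarith
  qed
  have "(\<lambda>k. b * (v k * v k) + b * ((v k * v k + v (Suc k) * v (Suc k)) / 2) + b * ((v k * v k + v' k * v' k) / 2))
      sums (b * V + b * ((V + (V - v 0 * v 0)) / 2) + b * ((V + V) / 2))"
    by (intro sums_add sums_mult sums_divide vv vSuc vPred)
  then have "(\<Sum>i\<in>S. c i * (c i * i) * N i) \<le> b * V + b * ((V + (V - v 0 * v 0)) / 2) + b * ((V + V) / 2)"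
    by (rule sums_le[OF vw_le vw])
  \<comment> \<open>The left side is at most \<open>3 * b * V\<close>; the factor 5 only matches
    \<open>T\<close>.\<close>
  also have "\<dots> \<le> (5 * b) * V"
  proof -
    have "0 \<le> b * (v 0 * v 0)" "0 \<le> b * V" using b V_pos by auto
    then show ?thesis by (simp add: algebra_simps)
  qed
  finally have "(\<Sum>i\<in>S. c i * (c i * i) * N i) \<le> (5 * b) * V" .
  moreover have "t * V \<le> (\<Sum>i\<in>S. c i * (c i * i) * N i)"
    unfolding V_def sum_distrib_left
  proof (rule sum_mono)
    fix i assume "i \<in> S"
    then have "t * ((c i)\<^sup>2 * N i) \<le> i * ((c i)\<^sup>2 * N i)"
      using S(3) N_ge[of i] by (intro mult_right_mono) auto
    then show "t * ((c i)\<^sup>2 * N i) \<le> c i * (c i * i) * N i"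
      by (simp add: power2_eq_square algebra_simps)
  qed
  ultimately have "t * V \<le> (5 * b) * V" by linarith
  then show ?thesis using V_pos by (simp add: T_def b_def)
qed

section \<open>Separation of eigenvalues of the same scale\<close>

text \<open>If \<open>x\<close> and \<open>y\<close> were too close, the head of the series of
  \<open>P k x * P k y\<close> would be nearly a sum of squares of order \<open>s ^ n\<close>, while
  its tail is too small to cancel it; yet the series sums to 0. All constants are independent of
  \<open>n\<close> because \<open>u (n + j) * q ^ n\<close> depends on \<open>j\<close>
  alone.\<close>

lemma spec_separated:
  assumes l: "0 < l" and U: "0 < U"
  shows "\<exists>\<delta>>0. \<forall>n. \<forall>x\<in>spec. \<forall>y\<in>spec. x \<noteq> y \<longrightarrow> l * q ^ n \<le> x \<longrightarrow> l * q ^ n \<le> y \<longrightarrow>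
    x \<le> U * q ^ n \<longrightarrow> y \<le> U * q ^ n \<longrightarrow> \<delta> * q ^ n \<le> \<bar>x - y\<bar>"
proof -
  define d where "d = D / g * q / (1 - q)"
  have d: "0 < d" using D_pos g q by (simp add: d_def)
  have u_q: "u (n + j) * q ^ n = d / q ^ j" for n j
    using q by (simp add: u_def d_def power_add)
  \<comment> \<open>Decay has started by row \<open>n + K\<close> when \<open>x\<close> is at least
    \<open>l * q ^ n\<close>.\<close>
  obtain K where K: "T * q ^ K \<le> l"
    using exists_q_power_le[OF l] by blast
  \<comment> \<open>Keeps \<open>R (n - M) x\<close> at least \<open>1 / 2\<close> when
    \<open>x\<close> is at most \<open>U * q ^ n\<close>.\<close>
  obtain M where M: "d * U * q ^ M \<le> ln (3 / 2)"
    using exists_q_power_le[of "ln (3 / 2)" "d * U"] by auto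
  define E where "E j = exp (d / q ^ j * U)" for j
  \<comment> \<open>The 8 collects a factor 4 from squaring \<open>1 / 2\<close> and a factor 2 from
    the polarization below.\<close>
  define c0 where "c0 = m / s ^ M / 8"
  have c0: "0 < c0" using m s by (simp add: c0_def)
  define A where "A = C * s ^ K * (E K)\<^sup>2"
  have A: "0 < A" using C_pos s by (simp add: A_def E_def)
  \<comment> \<open>The product of two decaying terms gains \<open>1 / 4\<close> per row, with
    geometric sum \<open>4 / 3\<close>; \<open>J\<close> extra rows push the tail below
    \<open>c0 / 2 * s ^ n\<close>.\<close>
  obtain J where "A * (4 / 3) * (1 / 4) ^ J \<le> c0 / 2"
    using exists_scaled_power_le[of "1 / 4" "c0 / 2" "A * (4 / 3)"] c0 by auto
  moreover have "A * (4 / 3) * (1 / 4) ^ Suc J \<le> A * (4 / 3) * (1 / 4) ^ J"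
    using A by simp
  ultimately have J: "A * (4 / 3) * (1 / 4) ^ Suc J \<le> c0 / 2" by linarith
  define L where "L = K + Suc J"
  define F where "F = d / q ^ L * E L"
  define G where "G = D * C * s ^ L * F\<^sup>2"
  have F: "0 < F" using d q by (simp add: F_def E_def)
  have G: "0 < G" using D_pos C_pos s F by (simp add: G_def)
  \<comment> \<open>Chosen so that \<open>G * \<delta>^2 = c0\<close>, where
    \<open>G * z^2 * s ^ n\<close> will bound the weighted squared differences of
    \<open>R\<close>.\<close>
  define \<delta> where "\<delta> = sqrt (c0 / G)"
  have \<delta>: "0 < \<delta>" using c0 G by (simp add: \<delta>_def)
  have "\<delta> * q ^ n \<le> \<bar>x - y\<bar>"
    if xy: "x \<in> spec" "y \<in> spec" "x \<noteq> y" and lo: "l * q ^ n \<le> x" "l * q ^ n \<le> y"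
      and up: "x \<le> U * q ^ n" "y \<le> U * q ^ n" for n x y
  proof (rule ccontr)
    assume close: "\<not> \<delta> * q ^ n \<le> \<bar>x - y\<bar>"
    define N where "N = n + L"
    have pos: "0 < x" "0 < y" using xy by (auto simp: spec_def)
    have qn: "0 < q ^ n" using q by simp
    have sn: "0 < s ^ n" using s by simp
    have T_le: "T * q ^ (n + K) \<le> l * q ^ n"
      using mult_right_mono[OF K, of "q ^ n"] qn by (simp add: power_add algebra_simps)
    have tail: "\<bar>P (N + j) x * P (N + j) y\<bar> \<le> A * s ^ n * (1 / 4) ^ Suc J * (1 / 4) ^ j" for j
    proof -
      have P_le: "\<bar>P (N + j) z\<bar> \<le> sqrt (C * s ^ (n + K)) * E K * (1 / 2) ^ (Suc J + j)"
        if "z \<in> spec" "l * q ^ n \<le> z" "z \<le> U * q ^ n" for z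
      proof -
        have z: "0 < z" using that by (simp add: spec_def)
        have "u (n + K) * z \<le> u (n + K) * (U * q ^ n)"
          using that u_pos[of "n + K"] by (intro mult_left_mono) auto
        also have "\<dots> = d / q ^ K * U"
          using u_q[of n K] by (simp add: algebra_simps)
        finally have "\<bar>R (n + K) z\<bar> \<le> E K"
          using abs_R_le[of "n + K" z] z unfolding E_def by (smt (verit) exp_le_cancel_iff abs_of_pos)
        then have "\<bar>P (n + K) z\<bar> \<le> sqrt (C * s ^ (n + K)) * E K"
          unfolding P_def abs_mult using h_upper[of "n + K"] h_pos[of "n + K"] by (intro mult_mono) auto
        then have "\<bar>P (n + K) z\<bar> * (1 / 2) ^ (Suc J + j) \<le> sqrt (C * s ^ (n + K)) * E K * (1 / 2) ^ (Suc J + j)"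
          by (rule mult_right_mono) simp
        moreover have "\<bar>P (n + K + (Suc J + j)) z\<bar> \<le> \<bar>P (n + K) z\<bar> * (1 / 2) ^ (Suc J + j)"
          using T_le that by (intro spec_decay) auto
        moreover have N: "N + j = n + K + (Suc J + j)" by (simp add: N_def L_def)
        ultimately show ?thesis unfolding N by linarith
      qed
      have "\<bar>P (N + j) x\<bar> * \<bar>P (N + j) y\<bar> \<le> (sqrt (C * s ^ (n + K)) * E K * (1 / 2) ^ (Suc J + j)) *
          (sqrt (C * s ^ (n + K)) * E K * (1 / 2) ^ (Suc J + j))"
        using P_le[OF xy(1) lo(1) up(1)] P_le[OF xy(2) lo(2) up(2)] C_pos s
        by (intro mult_mono) (auto simp: E_def)
      also have "\<dots> = (sqrt (C * s ^ (n + K)))\<^sup>2 * (E K)\<^sup>2 * ((1 / 2) ^ (Suc J + j) * (1 / 2) ^ (Suc J + j))"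
        by (simp only: power2_eq_square mult_ac)
      also have "(sqrt (C * s ^ (n + K)))\<^sup>2 = C * s ^ (n + K)"
        using C_pos s by simp
      also have "(1 / 2 :: real) ^ (Suc J + j) * (1 / 2) ^ (Suc J + j) = (1 / 2 * (1 / 2)) ^ (Suc J + j)"
        by (rule power_mult_distrib[symmetric])
      also have "\<dots> = (1 / 4) ^ Suc J * (1 / 4) ^ j"
        by (simp add: power_add)
      finally show ?thesis by (simp add: abs_mult A_def power_add algebra_simps)
    qed
    have sums: "(\<lambda>k. P k x * P k y) sums 0"
      using spec_orthogonal xy by blast
    have "\<bar>\<Sum>k<N. P k x * P k y\<bar> \<le> c0 / 2 * s ^ n"
    proof -
      have geo: "(\<lambda>j. A * s ^ n * (1 / 4) ^ Suc J * (1 / 4) ^ j) sums (A * s ^ n * (1 / 4) ^ Suc J * (1 / (1 - 1 / 4)))"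
        by (intro sums_mult geometric_sums) simp
      have "(\<lambda>j. P (j + N) x * P (j + N) y) sums (0 - (\<Sum>k<N. P k x * P k y))"
        by (rule sums_split_initial_segment[OF sums])
      then have tl: "(\<lambda>j. P (N + j) x * P (N + j) y) sums - (\<Sum>k<N. P k x * P k y)"
        by (simp add: add.commute)
      have "- (\<Sum>k<N. P k x * P k y) \<le> A * s ^ n * (1 / 4) ^ Suc J * (1 / (1 - 1 / 4))"
        by (rule sums_le[OF _ tl geo]) (use tail abs_le_D1 in blast)
      moreover have "- (- (\<Sum>k<N. P k x * P k y)) \<le> A * s ^ n * (1 / 4) ^ Suc J * (1 / (1 - 1 / 4))"
        by (rule sums_le[OF _ sums_minus[OF tl] geo]) (use tail abs_le_D2 in blast)
      moreover have "A * s ^ n * (1 / 4) ^ Suc J * (1 / (1 - 1 / 4)) \<le> c0 / 2 * s ^ n"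
        using mult_right_mono[OF J, of "s ^ n"] sn by (simp add: algebra_simps)
      ultimately show ?thesis by linarith
    qed
    \<comment> \<open>Polarization: a product is half the sum of the squares minus half the squared
      difference. One square is dropped, and of the others only index \<open>i\<close> is
      kept.\<close>
    moreover have "(\<Sum>k<N. P k x * P k y) \<ge> c0 * s ^ n - (\<Sum>k<N. h k * (R k x - R k y)\<^sup>2) / 2"
    proof -
      \<comment> \<open>Truncated subtraction: for \<open>n \<le> M\<close> this is 0, where
        \<open>R\<close> is 1.\<close>
      define i where "i = n - M"
      have i: "i < N" by (simp add: i_def N_def L_def)
      have Ri: "1 / 2 \<le> R i x"
      proof (cases "n \<le> M")
        case True
        then show ?thesis by (simp add: i_def R_0)
      next
        case False
        then have n: "n = i + M" by (simp add: i_def)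
        have "u i * x \<le> u i * (U * q ^ n)"
          using up u_pos[of i] by (intro mult_left_mono) auto
        also have "\<dots> = d * U * q ^ M"
          using u_q[of i 0] by (simp add: n power_add algebra_simps)
        also have "\<dots> \<le> ln (3 / 2)" by (rule M)
        finally have "exp (u i * \<bar>x\<bar>) \<le> 3 / 2"
          using pos by (simp add: ln_ge_iff)
        then show ?thesis using abs_R_minus_1_le[of i x] by linarith
      qed
      have "s ^ n \<le> s ^ (i + M)"
        using s by (intro power_increasing) (auto simp: i_def)
      then have "m * (s ^ n / s ^ M) \<le> m * s ^ i"
        using s m by (simp add: power_add field_simps)
      also have "\<dots> \<le> h i" by (rule h_lower)
      finally have hi: "c0 * 8 * s ^ n \<le> h i" by (simp add: c0_def)
      have "c0 * 8 * s ^ n * (1 / 2)\<^sup>2 \<le> h i * (R i x)\<^sup>2"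
        using hi Ri h_pos[of i] by (intro mult_mono power_mono) auto
      also have "\<dots> \<le> (\<Sum>k<N. h k * (R k x)\<^sup>2)"
        using i h_pos by (intro member_le_sum) (auto simp: less_imp_le)
      finally have 1: "c0 * s ^ n \<le> (\<Sum>k<N. h k * (R k x)\<^sup>2) / 2"
        by (simp add: power2_eq_square)
      have "(\<Sum>k<N. h k * (R k x)\<^sup>2) / 2 - (\<Sum>k<N. h k * (R k x - R k y)\<^sup>2) / 2
          = (\<Sum>k<N. h k * (R k x)\<^sup>2 / 2 - h k * (R k x - R k y)\<^sup>2 / 2)"
        by (simp add: sum_subtractf sum_divide_distrib)
      also have "\<dots> \<le> (\<Sum>k<N. P k x * P k y)"
      proof (rule sum_mono)
        fix k
        have "P k x * P k y = h k * (R k x * R k y)"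
          using h_pos[of k] by (simp add: P_def algebra_simps)
        moreover have "(R k x)\<^sup>2 / 2 - (R k x - R k y)\<^sup>2 / 2 = R k x * R k y - (R k y)\<^sup>2 / 2"
          by (simp add: power2_eq_square field_simps)
        then have "(R k x)\<^sup>2 / 2 - (R k x - R k y)\<^sup>2 / 2 \<le> R k x * R k y"
          by simp
        then have "h k * ((R k x)\<^sup>2 / 2 - (R k x - R k y)\<^sup>2 / 2) \<le> h k * (R k x * R k y)"
          using h_pos[of k] by simp
        ultimately show "h k * (R k x)\<^sup>2 / 2 - h k * (R k x - R k y)\<^sup>2 / 2 \<le> P k x * P k y"
          by (simp add: algebra_simps)
      qed
      finally show ?thesis using 1 by linarith
    qed
    moreover have "(\<Sum>k<N. h k * (R k x - R k y)\<^sup>2) < c0 * s ^ n"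
    proof -
      define z where "z = \<bar>x - y\<bar> / q ^ n"
      have z: "0 < z" "z < \<delta>" using close qn xy by (auto simp: z_def field_simps)
      have "(R k x - R k y)\<^sup>2 \<le> (F * z)\<^sup>2" if "k \<le> N" for k
      proof -
        have ukN: "u k \<le> u N" using u_mono that .
        have uN: "u N * q ^ n = d / q ^ L" unfolding N_def by (rule u_q)
        have "exp (u k * (U * q ^ n)) \<le> exp (u N * (U * q ^ n))"
          using ukN U qn by (simp add: mult_right_mono)
        also have "\<dots> = E L"
          unfolding E_def uN[symmetric] by (simp add: algebra_simps)
        finally have e: "exp (u k * (U * q ^ n)) \<le> E L" .
        have "\<bar>R k x - R k y\<bar> \<le> u k * exp (u k * (U * q ^ n)) * \<bar>x - y\<bar>"
          using pos up by (intro R_lipschitz) auto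
        also have "\<dots> \<le> u N * E L * \<bar>x - y\<bar>"
          using ukN e u_pos[of k] by (intro mult_right_mono mult_mono) auto
        also have "\<dots> = u N * q ^ n * E L * z"
          using q by (simp add: z_def)
        also have "\<dots> = F * z"
          unfolding uN F_def by simp
        finally show ?thesis using power_mono[of "\<bar>R k x - R k y\<bar>" "F * z" 2] by simp
      qed
      then have "\<bar>\<Sum>k\<le>N. h k * (R k x - R k y)\<^sup>2\<bar> \<le> D * h N * (F * z)\<^sup>2"
        by (intro h_weighted_sum_le) auto
      moreover have "(\<Sum>k<N. h k * (R k x - R k y)\<^sup>2) \<le> (\<Sum>k\<le>N. h k * (R k x - R k y)\<^sup>2)"
        using h_pos by (intro sum_mono2) (auto simp: less_imp_le)
      ultimately have "(\<Sum>k<N. h k * (R k x - R k y)\<^sup>2) \<le> D * h N * (F * z)\<^sup>2"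
        by linarith
      also have "\<dots> \<le> D * (C * s ^ N) * (F * z)\<^sup>2"
        using D_pos h_upper by (intro mult_right_mono mult_left_mono) auto
      also have "\<dots> = G * z\<^sup>2 * s ^ n"
        by (simp add: G_def N_def power_add power_mult_distrib algebra_simps)
      also have "\<dots> < G * \<delta>\<^sup>2 * s ^ n"
        using z sn G by (simp add: power_strict_mono)
      also have "G * \<delta>\<^sup>2 = c0"
        using c0 G by (simp add: \<delta>_def)
      finally show ?thesis .
    qed
    ultimately show False by linarith
  qed
  then show ?thesis using \<delta> by blast
qed

end

section \<open>Decreasing enumeration of a set accumulating only at 0\<close>

text \<open>Ranks are counted from the top, so removing the minimum leaves the ranks of all other
  points unchanged.\<close>

lemma exists_rank_finite:
  fixes A :: "real set"
  assumes "finite A" "1 \<le> n" "n \<le> card A"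
  shows "\<exists>x\<in>A. card (A \<inter> {x..}) = n"
  using assms
proof (induction "card A" arbitrary: A)
  case 0
  then show ?case by simp
next
  case (Suc k)
  then have A: "finite A" "A \<noteq> {}" by auto
  let ?x = "Min A"
  have x: "?x \<in> A" using A by simp
  show ?case
  proof (cases "n = card A")
    case True
    have "A \<inter> {?x..} = A" using A by auto
    then show ?thesis using x True by (intro bexI[of _ ?x]) simp_all
  next
    case False
    then have "\<exists>y\<in>A - {?x}. card ((A - {?x}) \<inter> {y..}) = n"
      using Suc x A by (intro Suc.hyps(1)) auto
    then obtain y where y: "y \<in> A - {?x}" "card ((A - {?x}) \<inter> {y..}) = n" by blast
    have "?x \<le> y" using y A by simp
    then have "(A - {?x}) \<inter> {y..} = A \<inter> {y..}" using y by auto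
    then show ?thesis using y by auto
  qed
qed

text \<open>\<open>\<xi> n\<close> is the point of rank \<open>n\<close>. Rank is strictly
  decreasing in the point, so each point is determined by its rank and the whole set is
  reached.\<close>

lemma exists_decreasing_enumeration:
  fixes E :: "real set"
  assumes pos: "\<And>x. x \<in> E \<Longrightarrow> 0 < x"
    and fin: "\<And>t. 0 < t \<Longrightarrow> finite (E \<inter> {t..})" and inf: "infinite E"
  obtains \<xi> :: "nat \<Rightarrow> real"
    where "\<And>n. 1 \<le> n \<Longrightarrow> \<xi> n \<in> E \<and> card (E \<inter> {\<xi> n..}) = n" "E = \<xi> ` {1..}"
proof -
  have ex: "\<exists>x\<in>E. card (E \<inter> {x..}) = n" if n: "1 \<le> n" for n
  proof -
    obtain F where F: "finite F" "card F = n" "F \<subseteq> E"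
      using infinite_arbitrarily_large[OF inf] by blast
    then have "F \<noteq> {}" using n by auto
    then have t: "0 < Min F" "F \<subseteq> E \<inter> {Min F..}" using F pos by auto
    then have "n \<le> card (E \<inter> {Min F..})"
      using F card_mono[OF fin[OF t(1)] t(2)] by simp
    then obtain x where x: "x \<in> E \<inter> {Min F..}" "card (E \<inter> {Min F..} \<inter> {x..}) = n"
      using exists_rank_finite[OF fin[OF t(1)] n] by blast
    then have "E \<inter> {Min F..} \<inter> {x..} = E \<inter> {x..}" by auto
    then show ?thesis using x by auto
  qed
  define \<xi> where "\<xi> n = (SOME x. x \<in> E \<and> card (E \<inter> {x..}) = n)" for n
  have \<xi>: "\<xi> n \<in> E \<and> card (E \<inter> {\<xi> n..}) = n" if "1 \<le> n" for n
    unfolding \<xi>_def by (rule someI_ex) (use ex[OF that] in blast)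
  have less: "card (E \<inter> {y..}) < card (E \<inter> {x..})" if "x \<in> E" "y \<in> E" "x < y" for x y
  proof (rule psubset_card_mono[OF fin[OF pos[OF that(1)]]])
    have "E \<inter> {y..} \<subseteq> E \<inter> {x..}" "x \<in> E \<inter> {x..}" "x \<notin> E \<inter> {y..}"
      using that by auto
    then show "E \<inter> {y..} \<subset> E \<inter> {x..}" by blast
  qed
  have "x \<in> \<xi> ` {1..}" if x: "x \<in> E" for x
  proof -
    define n where "n = card (E \<inter> {x..})"
    have "x \<in> E \<inter> {x..}" using x by simp
    then have "n \<noteq> 0" unfolding n_def using fin[OF pos[OF x]] card_0_eq by blast
    then have n: "1 \<le> n" by simp
    have "\<not> x < \<xi> n" "\<not> \<xi> n < x"
      using \<xi>[OF n] less[of x "\<xi> n"] less[of "\<xi> n" x] x n_def by linarith+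
    then show ?thesis using n by (intro image_eqI[of _ _ n]) auto
  qed
  then have "E = \<xi> ` {1..}" using \<xi> by auto
  then show ?thesis using \<xi> that by blast
qed

section \<open>The orthogonality measure is carried by \<open>spec\<close>\<close>

locale geometric_recurrence_measure =
  geometric_recurrence \<alpha> \<gamma> h R q s g B m C + prob_space \<mu>
  for \<alpha> \<gamma> h R q s g B m C and \<mu> :: "real measure" +
  assumes sets_mu: "sets \<mu> = sets borel"
    and orth: "has_bochner_integral \<mu> (\<lambda>x. P n x * P k x) (if n = k then 1 else 0)"
begin

lemma P_measurable [measurable]: "P n \<in> borel_measurable \<mu>"
  using orth[of n 0] by (auto simp: P_0 has_bochner_integral_iff dest: borel_measurable_integrable)

lemma P_square: "has_bochner_integral \<mu> (\<lambda>x. (P n x)\<^sup>2) 1"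
  using orth[of n n] by (simp add: power2_eq_square)

lemma span_square:
  "has_bochner_integral \<mu> (\<lambda>x. (\<Sum>k\<le>n. a k * P k x)\<^sup>2) (\<Sum>k\<le>n. (a k)\<^sup>2)"
proof -
  have "has_bochner_integral \<mu> (\<lambda>x. \<Sum>i\<le>n. \<Sum>j\<le>n. a i * a j * (P i x * P j x))
      (\<Sum>i\<le>n. \<Sum>j\<le>n. a i * a j * (if i = j then 1 else 0))"
    by (intro has_bochner_integral_sum has_bochner_integral_mult_right orth)
  moreover have "(\<Sum>i\<le>n. \<Sum>j\<le>n. a i * a j * (if i = j then 1 else 0)) = (\<Sum>k\<le>n. (a k)\<^sup>2)"
    by (intro sum.cong) (auto simp: power2_eq_square if_distrib cong: if_cong)
  ultimately show ?thesis
    by (simp add: power2_eq_square sum_product algebra_simps)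
qed

text \<open>Chebyshev's inequality for \<open>(P n x)^2\<close>, whose integral is 1.\<close>

lemma prob_le_if_R_ge:
  assumes "A \<in> sets borel" "0 \<le> r" "\<And>x. x \<in> A \<Longrightarrow> r \<le> R n x"
  shows "h n * r\<^sup>2 * prob A \<le> 1"
proof -
  have A: "A \<in> sets \<mu>" using assms sets_mu by simp
  have "h n * r\<^sup>2 * indicator A x \<le> (P n x)\<^sup>2" for x
    using assms(2) assms(3)[of x] h_pos[of n] power_mono[of r "R n x" 2]
    by (auto simp: P_def power_mult_distrib split: split_indicator)
  moreover have "has_bochner_integral \<mu> (\<lambda>x. h n * r\<^sup>2 * indicator A x) (h n * r\<^sup>2 * prob A)"
    using A by (intro has_bochner_integral_mult_right has_bochner_integral_real_indicator)
      (auto simp: emeasure_eq_measure)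
  ultimately show ?thesis
    using P_square[of n] integral_mono[of \<mu> "\<lambda>x. h n * r\<^sup>2 * indicator A x" "\<lambda>x. (P n x)\<^sup>2"]
    by (simp only: has_bochner_integral_iff)
qed

lemma exists_s_power_le: "0 < l \<Longrightarrow> \<exists>n. K / s ^ n \<le> l"
  using exists_scaled_power_le[of "1 / s" l K] s by (simp add: power_divide)

text \<open>By \<open>R_ge_1\<close> the mass of the nonpositive axis is at most
  \<open>1 / h n\<close> for every \<open>n\<close>, and \<open>h n\<close> is unbounded.\<close>

lemma AE_pos: "AE x in \<mu>. 0 < x"
proof -
  have "prob {..0} = 0"
  proof (rule ccontr)
    assume "prob {..0} \<noteq> 0"
    then have "0 < prob {..0} / 2" by (simp add: zero_less_measure_iff)
    then obtain n where "1 / m / s ^ n \<le> prob {..0} / 2" using exists_s_power_le by blast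
    then have "1 \<le> m * s ^ n * (prob {..0} / 2)" using m s by (simp add: field_simps)
    also have "\<dots> \<le> h n * (prob {..0} / 2)" using h_lower by (intro mult_right_mono) auto
    also have "\<dots> \<le> 1 / 2" using prob_le_if_R_ge[of "{..0}" 1 n] R_ge_1 by simp
    finally show False by simp
  qed
  then have "{..0} \<in> null_sets \<mu>"
    using sets_mu by (simp add: null_sets_def emeasure_eq_measure)
  then show ?thesis
    by (rule AE_I') auto
qed

text \<open>The expected value of the series is the sum of \<open>(1 / 2) ^ k\<close>. The weight
  makes it finite but is still beaten by the growth of \<open>(P k x)^2\<close> in
  \<open>P_growth\<close>.\<close>

lemma AE_summable: "AE x in \<mu>. summable (\<lambda>k. (1 / 2) ^ k * (P k x)\<^sup>2)"
proof -
  have "(\<integral>\<^sup>+x. (\<Sum>k. ennreal ((1 / 2) ^ k * (P k x)\<^sup>2)) \<partial>\<mu>)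
      = (\<Sum>k. \<integral>\<^sup>+x. ennreal ((1 / 2) ^ k * (P k x)\<^sup>2) \<partial>\<mu>)"
    by (rule nn_integral_suminf) measurable
  also have "\<dots> = (\<Sum>k. ennreal ((1 / 2) ^ k))"
  proof (rule suminf_cong)
    fix k
    have "has_bochner_integral \<mu> (\<lambda>x. (1 / 2) ^ k * (P k x)\<^sup>2) ((1 / 2) ^ k * 1)"
      by (intro has_bochner_integral_mult_right P_square)
    then show "(\<integral>\<^sup>+x. ennreal ((1 / 2) ^ k * (P k x)\<^sup>2) \<partial>\<mu>) = ennreal ((1 / 2) ^ k)"
      by (subst nn_integral_eq_integral) (auto simp: has_bochner_integral_iff)
  qed
  also have "\<dots> = ennreal (\<Sum>k. (1 / 2) ^ k)"
    by (rule suminf_ennreal2) (auto intro: summable_geometric)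
  finally have "(\<integral>\<^sup>+x. (\<Sum>k. ennreal ((1 / 2) ^ k * (P k x)\<^sup>2)) \<partial>\<mu>) \<noteq> \<infinity>"
    by simp
  then have "AE x in \<mu>. (\<Sum>k. ennreal ((1 / 2) ^ k * (P k x)\<^sup>2)) \<noteq> \<infinity>"
    by (intro nn_integral_noteq_infinite) measurable
  then show ?thesis
    by eventually_elim (auto intro!: summable_suminf_not_top)
qed

text \<open>Off \<open>spec\<close> the squares grow by a factor 4 per row, so the terms of the
  series in \<open>AE_summable\<close> stay above some \<open>a > 0\<close>.\<close>

lemma AE_spec: "AE x in \<mu>. x \<in> spec"
  using AE_pos AE_summable
proof eventually_elim
  case (elim x)
  show ?case
  proof (rule ccontr)
    assume "x \<notin> spec"
    then obtain k where k: "T * q ^ k \<le> x" "\<bar>P k x\<bar> < 2 * \<bar>P (Suc k) x\<bar>"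
      using elim by (auto simp: spec_def not_le)
    define a where "a = (1 / 2) ^ Suc k * (P (Suc k) x)\<^sup>2"
    have a: "0 < a" using k by (auto simp: a_def)
    have "a \<le> (1 / 2) ^ (j + Suc k) * (P (j + Suc k) x)\<^sup>2" for j
    proof -
      have "(2 ^ j * \<bar>P (Suc k) x\<bar>)\<^sup>2 \<le> \<bar>P (Suc k + j) x\<bar>\<^sup>2"
        by (intro power_mono P_growth k) auto
      then have "(1 / 2) ^ (j + Suc k) * ((2 ^ j)\<^sup>2 * (P (Suc k) x)\<^sup>2) \<le> (1 / 2) ^ (j + Suc k) * (P (j + Suc k) x)\<^sup>2"
        by (intro mult_left_mono) (auto simp: power_mult_distrib add.commute)
      moreover have "(1 / 2) ^ (j + Suc k) * ((2 ^ j)\<^sup>2 * (P (Suc k) x)\<^sup>2) = 2 ^ j * a"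
        by (simp add: a_def power_add power2_eq_square field_simps)
      moreover have "1 * a \<le> 2 ^ j * a"
        using a by (intro mult_right_mono) auto
      ultimately show ?thesis by linarith
    qed
    moreover have "(\<lambda>j. (1 / 2) ^ (j + Suc k) * (P (j + Suc k) x)\<^sup>2) \<longlonglongrightarrow> 0"
      using LIMSEQ_ignore_initial_segment[OF summable_LIMSEQ_zero[OF elim(2)]] .
    ultimately have "a \<le> 0"
      using LIMSEQ_le_const by blast
    then show False using a by simp
  qed
qed

section \<open>Mass near the origin\<close>

lemma prob_upper:
  assumes "0 \<le> x" "u n * x \<le> ln (3 / 2)"
  shows "h n * prob {0..x} \<le> 4"
proof -
  have "1 / 2 \<le> R n y" if "y \<in> {0..x}" for y
  proof -
    have "u n * y \<le> u n * x" using that u_pos[of n] by simp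
    then have "u n * \<bar>y\<bar> \<le> ln (3 / 2)" using that assms(2) by simp
    then have "exp (u n * \<bar>y\<bar>) \<le> 3 / 2" by (simp add: ln_ge_iff)
    then show ?thesis using abs_R_minus_1_le[of n y] by linarith
  qed
  then show ?thesis using prob_le_if_R_ge[of "{0..x}" "1 / 2" n] by (simp add: power2_eq_square)
qed

lemma u_scale: "u (n + j) * q ^ n = u 0 / q ^ j"
  using q by (simp add: u_def power_add)

lemma h_ratio_le: "h n \<le> C / m * h (Suc n)"
proof -
  have "h n \<le> C * s ^ n" by (rule h_upper)
  also have "\<dots> \<le> C * s ^ Suc n" using C_pos s by simp
  also have "\<dots> = C / m * (m * s ^ Suc n)" using m by simp
  also have "\<dots> \<le> C / m * h (Suc n)" by (rule mult_left_mono[OF h_lower]) (use C_pos m in simp)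
  finally show ?thesis .
qed

text \<open>The kernel polynomial \<open>f\<close> has squared norm at least \<open>h n\<close>. By
  \<open>R_diff\<close>, \<open>x * f x\<close> involves only \<open>R n\<close> and
  \<open>R (Suc n)\<close>, so at most half of \<open>h n\<close> comes from beyond
  \<open>X * q ^ n\<close>; the other half must come from the interval, where \<open>f\<close> is at
  most \<open>F * h n\<close>.\<close>

lemma prob_lower: "\<exists>X>0. \<exists>c>0. \<forall>n. c \<le> h n * prob {0..X * q ^ n}"
proof -
  \<comment> \<open>The integral of \<open>(x * f x)^2\<close> is at most
    \<open>W * q ^ (2 * n) * h n\<close>; taking \<open>X^2 = 2 * W\<close> leaves
    \<open>h n / 2\<close> after division by \<open>a\<close>.\<close>
  define W where "W = 2 * B\<^sup>2 * (1 + C / m)"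
  have W: "0 < W" using B_pos C_pos m by (simp add: W_def add_pos_pos)
  define X where "X = sqrt (2 * W)"
  have X: "0 < X" "X\<^sup>2 = 2 * W" using W by (auto simp: X_def)
  define F where "F = D * exp (u 0 * X)"
  have F: "0 < F" using D_pos by (simp add: F_def)
  have "1 / (2 * F\<^sup>2) \<le> h n * prob {0..X * q ^ n}" for n
  proof -
    have qn: "0 < q ^ n" using q by simp
    define f where "f x = (\<Sum>k\<le>n. h k * R k x)" for x
    define a where "a = (X * q ^ n)\<^sup>2"
    define I where "I = {0..X * q ^ n}"
    have a: "0 < a" using mult_pos_pos[OF X(1) qn] unfolding a_def by (rule zero_less_power)
    have "f x = (\<Sum>k\<le>n. sqrt (h k) * P k x)" for x
      using h_pos by (simp add: f_def P_def less_imp_le flip: mult.assoc)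
    then have f_int: "has_bochner_integral \<mu> (\<lambda>x. (f x)\<^sup>2) (\<Sum>k\<le>n. h k)"
      using span_square[of "\<lambda>k. sqrt (h k)" n] h_pos by (simp add: less_imp_le)
    define b where "b = 2 * (\<gamma> n * h n)\<^sup>2"
    have xf: "(x * f x)\<^sup>2 \<le> b * ((P (Suc n) x)\<^sup>2 / h (Suc n) + (P n x)\<^sup>2 / h n)" for x
    proof -
      have "x * f x = - (\<gamma> n * h n * (R (Suc n) x - R n x))"
        using R_diff[of n x] by (simp add: f_def)
      then have "(x * f x)\<^sup>2 = (\<gamma> n * h n)\<^sup>2 * (R (Suc n) x - R n x)\<^sup>2"
        by (simp add: power_mult_distrib)
      also have "\<dots> \<le> (\<gamma> n * h n)\<^sup>2 * (2 * ((R (Suc n) x)\<^sup>2 + (R n x)\<^sup>2))"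
      proof (rule mult_left_mono)
        have "0 \<le> (R (Suc n) x + R n x)\<^sup>2" by simp
        then show "(R (Suc n) x - R n x)\<^sup>2 \<le> 2 * ((R (Suc n) x)\<^sup>2 + (R n x)\<^sup>2)"
          by (simp add: power2_eq_square algebra_simps)
      qed simp
      also have "\<dots> = b * ((P (Suc n) x)\<^sup>2 / h (Suc n) + (P n x)\<^sup>2 / h n)"
        using h_pos[of n] h_pos[of "Suc n"] by (simp add: b_def P_def power_mult_distrib)
      finally show ?thesis .
    qed
    have le: "AE x in \<mu>. (f x)\<^sup>2 \<le> b * ((P (Suc n) x)\<^sup>2 / h (Suc n) + (P n x)\<^sup>2 / h n) / a + (F * h n)\<^sup>2 * indicator I x"
      using AE_pos
    proof eventually_elim
      case (elim x)
      show ?case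
      proof (cases "x \<in> I")
        case True
        then have x: "\<bar>x\<bar> \<le> X * q ^ n" by (simp add: I_def)
        have e: "exp (u n * (X * q ^ n)) = exp (u 0 * X)"
          using u_scale[of n 0] by (simp add: algebra_simps)
        have "\<bar>R k x\<bar> \<le> exp (u 0 * X)" if "k \<le> n" for k
          using abs_R_le[of k x] exp_u_mono[OF that x] unfolding e by linarith
        then have "\<bar>f x\<bar> \<le> D * h n * exp (u 0 * X)"
          unfolding f_def by (rule h_weighted_sum_le)
        then have "\<bar>f x\<bar> \<le> F * h n"
          by (simp add: F_def algebra_simps)
        then have "(f x)\<^sup>2 \<le> (F * h n)\<^sup>2"
          using power_mono[of "\<bar>f x\<bar>" "F * h n" 2] by simp
        moreover have "0 \<le> b * ((P (Suc n) x)\<^sup>2 / h (Suc n) + (P n x)\<^sup>2 / h n) / a"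
          using order_trans[OF _ xf[of x]] a by simp
        ultimately show ?thesis using True by simp
      next
        case False
        then have "X * q ^ n \<le> x" using elim by (simp add: I_def)
        then have "a \<le> x\<^sup>2" unfolding a_def using X qn by (intro power_mono) auto
        then have "a * (f x)\<^sup>2 \<le> (x * f x)\<^sup>2"
          by (simp add: power_mult_distrib mult_right_mono)
        then have "(f x)\<^sup>2 \<le> (x * f x)\<^sup>2 / a"
          using a by (simp add: field_simps)
        also have "\<dots> \<le> b * ((P (Suc n) x)\<^sup>2 / h (Suc n) + (P n x)\<^sup>2 / h n) / a"
          using xf a by (simp add: divide_right_mono)
        finally show ?thesis using False by simp
      qed
    qed
    have rhs: "has_bochner_integral \<mu>
        (\<lambda>x. b * ((P (Suc n) x)\<^sup>2 / h (Suc n) + (P n x)\<^sup>2 / h n) / a + (F * h n)\<^sup>2 * indicator I x)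
        (b * (1 / h (Suc n) + 1 / h n) / a + (F * h n)\<^sup>2 * prob I)"
      using sets_mu
      by (intro has_bochner_integral_add has_bochner_integral_mult_right has_bochner_integral_divide_zero
          P_square has_bochner_integral_real_indicator) (auto simp: I_def emeasure_eq_measure)
    have "(\<Sum>k\<le>n. h k) \<le> b * (1 / h (Suc n) + 1 / h n) / a + (F * h n)\<^sup>2 * prob I"
      using integral_mono_AE[OF _ _ le] f_int rhs by (auto simp: has_bochner_integral_iff)
    moreover have "h n \<le> (\<Sum>k\<le>n. h k)"
      using h_pos by (intro member_le_sum) (auto simp: less_imp_le)
    moreover have "b * (1 / h (Suc n) + 1 / h n) / a \<le> h n / 2"
    proof -
      have "1 / h (Suc n) \<le> C / m / h n"
        using divide_right_mono[OF h_ratio_le[of n], of "h n * h (Suc n)"] h_pos[of n] h_pos[of "Suc n"] by simp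
      then have "b * (1 / h (Suc n) + 1 / h n) \<le> b * ((1 + C / m) / h n)"
        by (intro mult_left_mono) (auto simp: b_def add_divide_distrib)
      also have "\<dots> = 2 * (\<gamma> n)\<^sup>2 * (1 + C / m) * h n"
        using h_pos[of n] by (simp add: b_def power2_eq_square)
      also have "\<dots> \<le> 2 * (B * q ^ n)\<^sup>2 * (1 + C / m) * h n"
        using gamma_le[of n] gamma_pos[of n] h_pos[of n] C_pos m
        by (intro mult_right_mono mult_left_mono power_mono) (auto simp: less_imp_le)
      also have "\<dots> = a * (h n / 2)"
        by (simp add: a_def power_mult_distrib X(2) W_def algebra_simps)
      finally show ?thesis using a by (simp add: field_simps)
    qed
    ultimately have "h n / 2 \<le> (F * h n)\<^sup>2 * prob I" by linarith
    then have "h n * (1 / 2) \<le> h n * (F\<^sup>2 * (h n * prob I))"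
      by (simp add: power2_eq_square algebra_simps)
    then have "1 / 2 \<le> F\<^sup>2 * (h n * prob I)"
      using h_pos[of n] mult_le_cancel_left_pos by blast
    then show ?thesis
      using F by (simp add: I_def field_simps)
  qed
  moreover have "0 < 1 / (2 * F\<^sup>2)" using F by simp
  ultimately show ?thesis using X(1) by blast
qed

section \<open>Lower bound for the eigenvalues by test polynomials\<close>

lemma P_span_mult:
  "\<exists>b. \<forall>x. (x - e) * (\<Sum>k\<le>n. a k * P k x) = (\<Sum>k\<le>Suc n. b k * P k x)"
proof (induction n)
  case 0
  have "(x - e) * (\<Sum>k\<le>0. a k * P k x) = (\<Sum>k\<le>Suc 0. (if k = 0 then a 0 * (\<gamma> 0 - e) else - a 0 * lam 0) * P k x)" for x
  proof -
    have "x * 1 = \<gamma> 0 - lam 0 * P (Suc 0) x"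
      using P_rec[of x 0] by (simp add: P_0 alpha_0)
    then have "a 0 * (x * 1) = a 0 * (\<gamma> 0 - lam 0 * P (Suc 0) x)"
      by (rule arg_cong)
    then show ?thesis by (simp add: P_0 algebra_simps)
  qed
  then show ?case by (intro exI allI)
next
  case (Suc n)
  then obtain b where b: "\<And>x. (x - e) * (\<Sum>k\<le>n. a k * P k x) = (\<Sum>k\<le>Suc n. b k * P k x)" by blast
  \<comment> \<open>\<open>b'\<close> extends \<open>b\<close> by 0, and \<open>d\<close> holds the
    three coefficients of \<open>a (Suc n) * (x - e) * P (Suc n) x\<close> given by the
    recurrence.\<close>
  define b' where "b' = (\<lambda>k. if k \<le> Suc n then b k else 0)"
  define d where "d = (\<lambda>k. if k = Suc (Suc n) then - a (Suc n) * lam (Suc n)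
     else if k = Suc n then a (Suc n) * (\<alpha> (Suc n) + \<gamma> (Suc n) - e) else if k = n then - a (Suc n) * lam n else 0)"
  have "(x - e) * (\<Sum>k\<le>Suc n. a k * P k x) = (\<Sum>k\<le>Suc (Suc n). (b' k + d k) * P k x)" for x
  proof -
    have x: "x * P (Suc n) x = (\<alpha> (Suc n) + \<gamma> (Suc n)) * P (Suc n) x - lam (Suc n) * P (Suc (Suc n)) x - lam n * P n x"
      using P_rec[of x "Suc n"] by simp
    have "(\<Sum>k\<le>n. d k * P k x) = - a (Suc n) * lam n * P n x"
      by (subst sum.remove[of _ n]) (auto simp: d_def)
    then have "(\<Sum>k\<le>Suc (Suc n). d k * P k x) = a (Suc n) * (x * P (Suc n) x) - a (Suc n) * e * P (Suc n) x"
      unfolding x by (simp add: d_def algebra_simps)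
    moreover have "(\<Sum>k\<le>Suc (Suc n). b' k * P k x) = (\<Sum>k\<le>Suc n. b k * P k x)"
      by (simp add: b'_def)
    moreover have "(x - e) * (\<Sum>k\<le>Suc n. a k * P k x)
        = (\<Sum>k\<le>Suc n. b k * P k x) + (a (Suc n) * (x * P (Suc n) x) - a (Suc n) * e * P (Suc n) x)"
      unfolding b[symmetric] by (simp add: algebra_simps)
    ultimately show ?thesis
      by (simp only: distrib_right sum.distrib)
  qed
  then show ?case by (intro exI allI)
qed

lemma P_span_prod:
  assumes "finite S" "card S \<le> n"
  shows "\<exists>a. \<forall>x. (\<Prod>e\<in>S. x - e) = (\<Sum>k\<le>n. a k * P k x)"
  using assms
proof (induction S arbitrary: n rule: finite_induct)
  case empty
  show ?case
    by (intro exI[of _ "\<lambda>k. if k = 0 then 1 else 0"]) (simp add: P_0 if_distrib if_distribR cong: if_cong)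
next
  case (insert e S)
  then obtain k where n: "n = Suc k" by (cases n) auto
  then obtain a where "\<And>x. (\<Prod>e\<in>S. x - e) = (\<Sum>j\<le>k. a j * P j x)"
    using insert by force
  then show ?case
    using P_span_mult[of e a k] insert.hyps by (simp add: n)
qed

text \<open>If \<open>spec\<close> outside \<open>S\<close> lay below
  \<open>\<epsilon> * q ^ n\<close>, a polynomial of degree at most \<open>n\<close> vanishing on
  \<open>S\<close> would have its whole norm over an interval of too little mass, and so would be
  zero.\<close>

lemma spec_count_lower:
  "\<exists>\<epsilon>>0. \<forall>n S. finite S \<longrightarrow> card S \<le> n \<longrightarrow> (\<exists>x\<in>spec - S. \<epsilon> * q ^ n < x)"
proof -
  \<comment> \<open>The mass of the interval is at most \<open>4 / h (n + K)\<close>, and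
    \<open>(R k x)^2 \<le> 9 / 4\<close> there; \<open>K\<close> makes the resulting factor at most
    \<open>1 / 2\<close>. Then \<open>\<epsilon>\<close> is chosen so that
    \<open>u (n + K) * \<epsilon> * q ^ n\<close> is exactly \<open>ln (3 / 2)\<close>.\<close>
  obtain K where "9 * D * (C / m) / s ^ K \<le> 1 / 2"
    using exists_s_power_le[of "1 / 2" "9 * D * (C / m)"] by auto
  then have K: "9 * D * C * 2 \<le> m * s ^ K"
    using m s by (simp add: field_simps)
  define \<epsilon> where "\<epsilon> = q ^ K * ln (3 / 2) / u 0"
  have ln: "0 < ln (3 / 2 :: real)" by simp
  have \<epsilon>: "0 < \<epsilon>" using ln q u_pos[of 0] by (simp add: \<epsilon>_def)
  have "\<exists>x\<in>spec - S. \<epsilon> * q ^ n < x" if S: "finite S" "card S \<le> n" for n S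
  proof (rule ccontr)
    assume "\<not> ?thesis"
    then have small: "x \<le> \<epsilon> * q ^ n" if "x \<in> spec" "x \<notin> S" for x
      using that by force
    obtain a where a: "\<And>x. (\<Prod>e\<in>S. x - e) = (\<Sum>k\<le>n. a k * P k x)"
      using P_span_prod[OF S] by blast
    define A where "A = (\<Sum>k\<le>n. (a k)\<^sup>2)"
    define I where "I = {0..\<epsilon> * q ^ n}"
    have le: "AE x in \<mu>. (\<Sum>k\<le>n. a k * P k x)\<^sup>2 \<le> A * (D * h n * (9 / 4)) * indicator I x"
      using AE_spec
    proof eventually_elim
      case (elim x)
      show ?case
      proof (cases "x \<in> S")
        case True
        then have "(\<Sum>k\<le>n. a k * P k x) = 0"
          using S by (auto simp flip: a)
        then show ?thesis
          using D_pos h_pos[of n] by (simp add: A_def sum_nonneg)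
      next
        case False
        then have x: "x \<in> I" "\<bar>x\<bar> \<le> \<epsilon> * q ^ n"
          using small elim by (auto simp: I_def spec_def)
        have "(R k x)\<^sup>2 \<le> 9 / 4" if "k \<le> n" for k
        proof -
          have "u n * (\<epsilon> * q ^ n) = (u (n + 0) * q ^ n) * \<epsilon>"
            by simp
          also have "\<dots> = q ^ K * ln (3 / 2)"
            unfolding u_scale using u_pos[of 0] by (simp add: \<epsilon>_def)
          also have "\<dots> \<le> ln (3 / 2)"
            using q ln by (intro mult_left_le_one_le) (auto simp: power_le_one)
          finally have "exp (u n * (\<epsilon> * q ^ n)) \<le> 3 / 2"
            by (simp add: ln_ge_iff)
          then have "\<bar>R k x\<bar> \<le> 3 / 2"
            using abs_R_le[of k x] exp_u_mono[OF that x(2)] by linarith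
          then show ?thesis
            using power_mono[of "\<bar>R k x\<bar>" "3 / 2" 2] by (simp add: power2_eq_square)
        qed
        then have "\<bar>\<Sum>k\<le>n. h k * (R k x)\<^sup>2\<bar> \<le> D * h n * (9 / 4)"
          by (intro h_weighted_sum_le) auto
        then have "(\<Sum>k\<le>n. (P k x)\<^sup>2) \<le> D * h n * (9 / 4)"
          using h_pos by (simp add: P_def power_mult_distrib less_imp_le)
        then have "A * (\<Sum>k\<le>n. (P k x)\<^sup>2) \<le> A * (D * h n * (9 / 4))"
          by (intro mult_left_mono) (auto simp: A_def sum_nonneg)
        then have "(\<Sum>k\<le>n. a k * P k x)\<^sup>2 \<le> A * (D * h n * (9 / 4))"
          using Cauchy_Schwarz_ineq_sum[of a "\<lambda>k. P k x" "{..n}"] unfolding A_def by linarith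
        then show ?thesis using x by simp
      qed
    qed
    have "has_bochner_integral \<mu> (\<lambda>x. A * (D * h n * (9 / 4)) * indicator I x) (A * (D * h n * (9 / 4)) * prob I)"
      using sets_mu by (intro has_bochner_integral_mult_right has_bochner_integral_real_indicator)
        (auto simp: I_def emeasure_eq_measure)
    then have "A \<le> A * (D * h n * (9 / 4)) * prob I"
      using integral_mono_AE[OF _ _ le] span_square[of a n] by (auto simp: has_bochner_integral_iff A_def)
    also have "\<dots> \<le> A * (1 / 2)"
    proof -
      have "u (n + K) * (\<epsilon> * q ^ n) = (u (n + K) * q ^ n) * \<epsilon>"
        by simp
      also have "\<dots> = ln (3 / 2)"
        unfolding u_scale using u_pos[of 0] q by (simp add: \<epsilon>_def)
      finally have "u (n + K) * (\<epsilon> * q ^ n) = ln (3 / 2)" .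
      then have p: "h (n + K) * prob I \<le> 4"
        unfolding I_def using \<epsilon> q by (intro prob_upper) auto
      have "9 * D * 2 * h n \<le> 9 * D * 2 * (C * s ^ n)"
        using D_pos h_upper by (intro mult_left_mono) auto
      also have "\<dots> \<le> m * s ^ (n + K)"
        using mult_right_mono[OF K, of "s ^ n"] s by (simp add: power_add algebra_simps)
      also have "\<dots> \<le> h (n + K)" by (rule h_lower)
      finally have "9 * D * 2 * h n * prob I \<le> h (n + K) * prob I"
        by (rule mult_right_mono) simp
      then have "D * h n * (9 / 4) * prob I \<le> 1 / 2" using p by linarith
      then show ?thesis
        using mult_left_mono[of "D * h n * (9 / 4) * prob I" "1 / 2" A] by (simp add: A_def sum_nonneg mult.assoc)
    qed
    finally have "A \<le> 0" by simp
    then have "A = 0" by (simp add: A_def sum_nonneg antisym)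
    then have "\<And>k. k \<le> n \<Longrightarrow> a k = 0"
      by (simp add: A_def sum_nonneg_eq_0_iff)
    \<comment> \<open>A product of linear factors vanishing everywhere would make the finite set
      \<open>S\<close> all of the reals.\<close>
    then have "(\<Prod>e\<in>S. x - e) = 0" for x
      by (simp add: a)
    then have "S = UNIV" using S(1) by auto
    then show False using S(1) infinite_UNIV_char_0[where 'a = real] by simp
  qed
  then show ?thesis using \<epsilon> by blast
qed

section \<open>Assembling the support sequence\<close>

lemma finite_spec_tail: "0 < t \<Longrightarrow> finite (spec \<inter> {t..})"
proof (rule ccontr)
  assume t: "0 < t" and inf: "infinite (spec \<inter> {t..})"
  obtain n where n: "T * q ^ n \<le> t / 2" using exists_q_power_le[of "t / 2"] t by auto
  obtain S where "finite S" "card S = Suc n" "S \<subseteq> spec \<inter> {t..}"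
    using infinite_arbitrarily_large[OF inf] by blast
  then have "t \<le> T * q ^ n"
    by (intro spec_count_upper[of S]) auto
  then show False using n t by simp
qed

text \<open>A finite \<open>spec\<close> could be taken as \<open>S\<close> in
  \<open>spec_count_lower\<close>, leaving no point.\<close>

lemma infinite_spec: "infinite spec"
  using spec_count_lower by blast

theorem decreasing_support:
  "\<exists>\<xi>. (\<forall>n\<ge>1. \<xi> (n + 1) < \<xi> n)
     \<and> prob (UNIV - {\<xi> n | n. n \<ge> 1}) = 0
     \<and> comparable_on {1..} \<xi> (\<lambda>n. q ^ n)
     \<and> (\<exists>\<delta>>0. \<forall>n\<ge>1. 1 - \<xi> (n + 1) / \<xi> n \<ge> \<delta>)
     \<and> comparable_on {1..} (\<lambda>n. prob {0..\<xi> n}) (\<lambda>n. 1 / s ^ n)"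
proof -
  obtain \<xi> where \<xi>: "\<And>n. 1 \<le> n \<Longrightarrow> \<xi> n \<in> spec \<and> card (spec \<inter> {\<xi> n..}) = n" "spec = \<xi> ` {1..}"
    using exists_decreasing_enumeration[of spec] finite_spec_tail infinite_spec by (auto simp: spec_def)
  obtain \<epsilon> where \<epsilon>: "0 < \<epsilon>" "\<And>n S. finite S \<Longrightarrow> card S \<le> n \<Longrightarrow> \<exists>x\<in>spec - S. \<epsilon> * q ^ n < x"
    using spec_count_lower by blast
  have pos: "0 < \<xi> n" if "1 \<le> n" for n using \<xi>(1)[OF that] by (simp add: spec_def)
  have fin: "finite (spec \<inter> {\<xi> n..})" if "1 \<le> n" for n using finite_spec_tail pos that by blast
  \<comment> \<open>The \<open>n\<close> points from \<open>\<xi> n\<close> upwards exceed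
    \<open>n - 1\<close> in number, so the bound is \<open>T * q ^ (n - 1)\<close>; dividing by
    \<open>q\<close> restores the index.\<close>
  define U where "U = T / q"
  have U: "0 < U" using T_pos q by (simp add: U_def)
  have upper: "\<xi> n \<le> U * q ^ n" if "1 \<le> n" for n
  proof -
    have "\<xi> n \<le> T * q ^ (n - 1)"
      using fin[OF that] \<xi>(1)[OF that] that by (intro spec_count_upper[of "spec \<inter> {\<xi> n..}"]) auto
    also have "\<dots> = U * q ^ n"
      using that q by (cases n) (auto simp: U_def)
    finally show ?thesis .
  qed
  have lower: "\<epsilon> * q ^ n \<le> \<xi> n" if "1 \<le> n" for n
  proof -
    \<comment> \<open>Removing the points above \<open>\<xi> n\<close> leaves only points that are
      at most \<open>\<xi> n\<close>, so the large point found must lie below or at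
      \<open>\<xi> n\<close>.\<close>
    let ?S = "spec \<inter> {\<xi> n..} - {\<xi> n}"
    have "card ?S \<le> n" using \<xi>(1)[OF that] fin[OF that] by simp
    moreover have "finite ?S" using fin[OF that] by simp
    ultimately obtain x where "x \<in> spec - ?S" "\<epsilon> * q ^ n < x"
      using \<epsilon>(2) by blast
    then show ?thesis by auto
  qed
  have dec: "\<xi> (n + 1) < \<xi> n" if "1 \<le> n" for n
  proof (rule ccontr)
    assume "\<not> ?thesis"
    then have "card (spec \<inter> {\<xi> (n + 1)..}) \<le> card (spec \<inter> {\<xi> n..})"
      using fin[OF that] by (intro card_mono) auto
    then show False using \<xi>(1)[of n] \<xi>(1)[of "n + 1"] that by simp
  qed
  have conc: "prob (UNIV - {\<xi> n | n. n \<ge> 1}) = 0"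
  proof -
    have "{\<xi> n | n. n \<ge> 1} = spec" using \<xi>(2) by auto
    moreover have "spec \<in> sets borel"
      unfolding \<xi>(2) by (rule sets.countable) auto
    ultimately show ?thesis
      using AE_spec sets_mu by (intro prob_eq_0[THEN iffD2]) auto
  qed
  have comp: "comparable_on {1..} \<xi> (\<lambda>n. q ^ n)"
    unfolding comparable_on_def
    using \<epsilon>(1) upper lower q by (intro exI[of _ \<epsilon>] exI[of _ U] conjI ballI) (auto simp: field_simps)
  have sep: "\<exists>\<delta>>0. \<forall>n\<ge>1. 1 - \<xi> (n + 1) / \<xi> n \<ge> \<delta>"
  proof -
    \<comment> \<open>The factor \<open>\<epsilon> * q\<close> accommodates
      \<open>\<xi> (n + 1)\<close>, which is only known to be at least
      \<open>\<epsilon> * q ^ (n + 1)\<close>.\<close>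
    obtain \<delta> where \<delta>: "0 < \<delta>" and sep: "\<And>n x y. x \<in> spec \<Longrightarrow> y \<in> spec \<Longrightarrow> x \<noteq> y \<Longrightarrow> \<epsilon> * q * q ^ n \<le> x \<Longrightarrow>
        \<epsilon> * q * q ^ n \<le> y \<Longrightarrow> x \<le> U * q ^ n \<Longrightarrow> y \<le> U * q ^ n \<Longrightarrow> \<delta> * q ^ n \<le> \<bar>x - y\<bar>"
      using spec_separated[of "\<epsilon> * q" U] \<epsilon>(1) q U by auto
    have "\<delta> / U \<le> 1 - \<xi> (n + 1) / \<xi> n" if n: "1 \<le> n" for n
    proof -
      have 1: "\<epsilon> * q * q ^ n \<le> \<xi> (n + 1)" using lower[of "n + 1"] by (simp add: mult.assoc)
      have "\<delta> * q ^ n \<le> \<bar>\<xi> n - \<xi> (n + 1)\<bar>"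
        using \<xi>(1)[of n] \<xi>(1)[of "n + 1"] 1 dec[OF n] upper[OF n] n
        by (intro sep) auto
      then have "\<delta> * q ^ n \<le> \<xi> n - \<xi> (n + 1)" using dec[OF n] by simp
      have "\<delta> / U * \<xi> n \<le> \<delta> / U * (U * q ^ n)"
        using upper[OF n] \<delta> U by (intro mult_left_mono) auto
      also have "\<dots> \<le> \<xi> n - \<xi> (n + 1)"
        using U \<open>\<delta> * q ^ n \<le> \<xi> n - \<xi> (n + 1)\<close> by simp
      finally show ?thesis using pos[OF n] by (simp add: field_simps)
    qed
    moreover have "0 < \<delta> / U" using \<delta> U by simp
    ultimately show ?thesis by blast
  qed
  have mass: "comparable_on {1..} (\<lambda>n. prob {0..\<xi> n}) (\<lambda>n. 1 / s ^ n)"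
  proof -
    obtain X c where X: "0 < X" and c: "0 < c" "\<And>n. c \<le> h n * prob {0..X * q ^ n}"
      using prob_lower by blast
    \<comment> \<open>\<open>L\<close> places the interval of \<open>prob_lower\<close> at index
      \<open>n + L\<close> inside that of \<open>\<xi> n\<close>; \<open>M\<close> makes
      \<open>prob_upper\<close> applicable at index \<open>n - M\<close>.\<close>
    obtain L where L: "X * q ^ L \<le> \<epsilon>" using exists_q_power_le[OF \<epsilon>(1)] by blast
    obtain M where M: "u 0 * U * q ^ M \<le> ln (3 / 2)" using exists_q_power_le[of "ln (3 / 2)"] by auto
    have up: "prob {0..\<xi> n} * s ^ n \<le> 4 * s ^ M / m + s ^ M" if n: "1 \<le> n" for n
    proof (cases "n \<le> M")
      case True
      have "prob {0..\<xi> n} * s ^ n \<le> 1 * s ^ M"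
        using True s by (intro mult_mono power_increasing) auto
      moreover have "0 \<le> 4 * s ^ M / m" using s m by simp
      ultimately show ?thesis by linarith
    next
      case False
      then obtain k where k: "n = k + M" by (metis add.commute le_Suc_ex nat_le_linear)
      have "u k * \<xi> n \<le> u k * (U * q ^ n)" using upper[OF n] u_pos[of k] by simp
      also have "\<dots> = u 0 * U * q ^ M" using u_scale[of k 0] by (simp add: k power_add algebra_simps)
      also have "\<dots> \<le> ln (3 / 2)" by (rule M)
      finally have "h k * prob {0..\<xi> n} \<le> 4" using pos[OF n] by (intro prob_upper) auto
      moreover have "m * s ^ k * prob {0..\<xi> n} \<le> h k * prob {0..\<xi> n}"
        using h_lower by (intro mult_right_mono) auto
      ultimately have "m * s ^ k * prob {0..\<xi> n} \<le> 4" by linarith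
      then have "m * s ^ k * prob {0..\<xi> n} * s ^ M \<le> 4 * s ^ M"
        using s by (intro mult_right_mono) auto
      then have "prob {0..\<xi> n} * s ^ n \<le> 4 * s ^ M / m"
        using m by (simp add: k power_add field_simps)
      moreover have "0 \<le> s ^ M" using s by simp
      ultimately show ?thesis by linarith
    qed
    have lo: "c / (C * s ^ L) \<le> prob {0..\<xi> n} * s ^ n" if n: "1 \<le> n" for n
    proof -
      have "X * q ^ (n + L) \<le> \<epsilon> * q ^ n"
        using mult_right_mono[OF L, of "q ^ n"] q by (simp add: power_add algebra_simps)
      then have "X * q ^ (n + L) \<le> \<xi> n" using lower[OF n] by linarith
      then have mono: "prob {0..X * q ^ (n + L)} \<le> prob {0..\<xi> n}"
        using sets_mu by (intro finite_measure_mono) auto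
      have "c \<le> h (n + L) * prob {0..X * q ^ (n + L)}" by (rule c)
      also have "\<dots> \<le> (C * s ^ (n + L)) * prob {0..\<xi> n}"
        using mono h_upper h_pos[of "n + L"] C_pos s by (intro mult_mono) auto
      finally show ?thesis
        using C_pos s by (simp add: power_add field_simps)
    qed
    have "0 < c / (C * s ^ L)" using c C_pos s by simp
    then show ?thesis
      unfolding comparable_on_def using up lo
      by (intro exI[of _ "c / (C * s ^ L)"] exI[of _ "4 * s ^ M / m + s ^ M"] conjI ballI) auto
  qed
  show ?thesis using dec conc comp sep mass by blast
qed

end

section \<open>From asymptotic hypotheses to uniform bounds\<close>

lemma ratio_tends_pos_upper:
  assumes "a \<approx>\<approx> b" "\<And>n. 0 < b n"
  shows "\<exists>G. \<forall>n. a n \<le> G * b n"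
proof -
  obtain L where "(\<lambda>n. a n / b n) \<longlonglongrightarrow> L"
    using assms(1) unfolding ratio_tends_pos_def by blast
  then have "Bseq (\<lambda>n. a n / b n)"
    by (intro convergent_imp_Bseq convergentI)
  then obtain G where "\<And>n. norm (a n / b n) \<le> G"
    unfolding Bseq_def by blast
  then have "a n / b n \<le> G" for n
    using abs_le_D1[of "a n / b n" G] by simp
  then have "a n \<le> G * b n" for n
    using assms(2) by (simp add: pos_divide_le_eq)
  then show ?thesis by blast
qed

lemma ratio_tends_pos_sym:
  assumes "a \<approx>\<approx> b"
  shows "b \<approx>\<approx> a"
proof -
  obtain L where "0 < L" "(\<lambda>n. a n / b n) \<longlonglongrightarrow> L"
    using assms unfolding ratio_tends_pos_def by blast
  then have "(\<lambda>n. inverse (a n / b n)) \<longlonglongrightarrow> inverse L"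
    by (intro tendsto_inverse) auto
  then show ?thesis
    unfolding ratio_tends_pos_def using \<open>0 < L\<close> by (intro exI[of _ "inverse L"]) simp
qed

theorem theorem1:
  fixes \<alpha> \<gamma> \<beta> lam h :: "nat \<Rightarrow> real"
    and R p :: "nat \<Rightarrow> real poly"
    and q \<kappa> s c :: real and N :: nat
    and \<mu> :: "real measure"
  assumes alpha_0: "\<alpha> 0 = 0"
    and gamma_pos: "\<And>n. \<gamma> n > 0"
    and alpha_pos: "\<And>n. \<alpha> (n + 1) > 0"
    and beta_eq: "\<And>n. \<beta> n = \<alpha> n + \<gamma> n"
    and lam_eq: "\<And>n. lam n = sqrt (\<alpha> (n + 1) * \<gamma> n)"
    and h_eq: "\<And>n. h n = (\<Prod>k<n. \<gamma> k) / (\<Prod>k=1..n. \<alpha> k)"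
    and R_0: "R 0 = 1"
    and R_rec: "\<And>n. [:0, 1:] * R n =
          - smult (\<gamma> n) (R (n + 1)) + smult (\<beta> n) (R n)
          - (if n = 0 then 0 else smult (\<alpha> n) (R (n - 1)))"
    and q: "0 < q" "q < 1"
    and alpha_asymp: "\<alpha> \<approx>\<approx> (\<lambda>n. q ^ n)"
    and gamma_asymp: "\<gamma> \<approx>\<approx> (\<lambda>n. q ^ n)"
    and kappa: "1 \<le> \<kappa>" "\<kappa> < inverse q + q - 1"
    and alpha_le: "\<And>n. \<alpha> n \<le> \<kappa> * \<gamma> n"
    and s: "s > 1"
    and h_sim: "comparable_on UNIV h (\<lambda>n. s ^ n)"
    and c: "(1 + q) / (1 + q\<^sup>2) < c" "c < 1 / q"
    and lam_le: "\<And>n. lam n \<le> \<beta> (n + 1) - c * \<beta> (n + 2)"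
    and beta_1: "\<beta> 1 \<le> \<beta> 0"
    and beta_diff: "\<And>n. n \<ge> N \<Longrightarrow>
          \<beta> n - c * \<beta> (n + 1) \<ge> \<beta> (n + 1) - c * \<beta> (n + 2)"
    and p_eq: "\<And>n. p n = smult (sqrt (h n)) (R n)"
    and mu_borel_prob: "prob_space \<mu>" "sets \<mu> = sets borel"
    and mu_orth: "orthonormal_wrt p \<mu>"
  shows "\<exists>\<xi> :: nat \<Rightarrow> real.
           (\<forall>n\<ge>1. \<xi> (n + 1) < \<xi> n)
         \<and> measure \<mu> (UNIV - {\<xi> n | n. n \<ge> 1}) = 0
         \<and> comparable_on {1..} \<xi> (\<lambda>n. q ^ n)
         \<and> (\<exists>\<delta>>0. \<forall>n\<ge>1. 1 - \<xi> (n + 1) / \<xi> n \<ge> \<delta>)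
         \<and> comparable_on {1..} (\<lambda>n. measure \<mu> {0..\<xi> n}) (\<lambda>n. 1 / s ^ n)"
proof -
  obtain A where A: "\<And>n. \<alpha> n \<le> A * q ^ n"
    using ratio_tends_pos_upper[OF alpha_asymp] q by auto
  obtain G where G: "\<And>n. \<gamma> n \<le> G * q ^ n"
    using ratio_tends_pos_upper[OF gamma_asymp] q by auto
  \<comment> \<open>The reversed relation yields the lower bound on \<open>\<gamma>\<close>, with
    constant \<open>1 / K\<close>.\<close>
  obtain K where K: "\<And>n. q ^ n \<le> K * \<gamma> n"
    using ratio_tends_pos_upper[OF ratio_tends_pos_sym[OF gamma_asymp] gamma_pos] by auto
  have K_pos: "0 < K"
  proof (rule zero_less_mult_pos2)
    show "0 < K * \<gamma> 0" using K[of 0] by simp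
  qed (rule gamma_pos)
  obtain m C where m: "0 < m" and h: "\<And>n. m \<le> h n / s ^ n \<and> h n / s ^ n \<le> C"
    using h_sim unfolding comparable_on_def by auto
  interpret base: geometric_recurrence \<alpha> \<gamma> h "\<lambda>n. poly (R n)" q s "1 / K" "A + G" m C
  proof
    fix n x
    show "1 / K * q ^ n \<le> \<gamma> n"
      using K[of n] K_pos by (simp add: field_simps)
    show "\<alpha> n + \<gamma> n \<le> (A + G) * q ^ n"
      using A[of n] G[of n] by (simp add: algebra_simps)
    show "m * s ^ n \<le> h n" "h n \<le> C * s ^ n"
      using h[of n] s by (simp_all add: field_simps)
    show "0 < \<alpha> (Suc n)"
      using alpha_pos[of n] by simp
    show "h (Suc n) * \<alpha> (Suc n) = \<gamma> n * h n"
      using alpha_pos[of n] by (simp add: h_eq)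
    have "poly ([:0, 1:] * R n) x = poly (- smult (\<gamma> n) (R (n + 1)) + smult (\<beta> n) (R n)
          - (if n = 0 then 0 else smult (\<alpha> n) (R (n - 1)))) x"
      by (rule arg_cong[OF R_rec])
    then show "\<gamma> n * (poly (R (Suc n)) x - poly (R n) x) =
        \<alpha> n * (poly (R n) x - poly (R (n - 1)) x) - x * poly (R n) x"
      by (cases n) (simp_all add: beta_eq alpha_0 algebra_simps)
  qed (use q s m K_pos alpha_0 in \<open>auto simp: h_eq R_0\<close>)
  interpret prob_space \<mu>
    by (rule mu_borel_prob)
  interpret geometric_recurrence_measure \<alpha> \<gamma> h "\<lambda>n. poly (R n)" q s "1 / K" "A + G" m C \<mu>
    by unfold_locales
      (use mu_borel_prob(2) mu_orth in \<open>auto simp: orthonormal_wrt_def p_eq base.P_def\<close>)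
  show ?thesis
    by (rule decreasing_support)
qed

end
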